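(* For every integer $s\geq 1$, the $s$-Club and $s$-Clique problems can be solved in polynomial time on graphs of degeneracy $1$.
   Context: The $s$-Club problem: given a graph $G$ and an integer $k$, decide whether there exists $S\subseteq V_G$ with $|S|\ge k$ such that for all $u,v\in S$, $\operatorname{dist}_{G[S]}(u,v)\le s$. The $s$-Clique problem is the same but with $\operatorname{dist}_G(u,v)\le s$ (distance in the whole graph). Graphs of degeneracy $1$ are exactly forests. *)

theory Defs
  imports
    "HOL-Library.Extended_Nat"
    "HOL-Computational_Algebra.Polynomial"
begin

section \<open>Graphs, distance, degeneracy\<close>

record 'a ugraph =
  verts :: "'a set"
  edges :: "'a set set"

definition simple_graph :: "'a ugraph \<Rightarrow> bool" where
  "simple_graph G \<longleftrightarrow> finite (verts G) \<and> (\<forall>e\<in>edges G. e \<subseteq> verts G \<and> card e = 2)"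

definition subgraph :: "'a ugraph \<Rightarrow> 'a ugraph \<Rightarrow> bool" where
  "subgraph H G \<longleftrightarrow> simple_graph H \<and> verts H \<subseteq> verts G \<and> edges H \<subseteq> edges G"

definition induced_subgraph :: "'a ugraph \<Rightarrow> 'a set \<Rightarrow> 'a ugraph" where
  "induced_subgraph G S = \<lparr>verts = verts G \<inter> S, edges = {e \<in> edges G. e \<subseteq> S}\<rparr>"

definition is_path :: "'a ugraph \<Rightarrow> 'a \<Rightarrow> 'a list \<Rightarrow> 'a \<Rightarrow> bool" where
  "is_path G u xs v \<longleftrightarrow>
     xs \<noteq> [] \<and> hd xs = u \<and> last xs = v \<and> distinct xs \<and> set xs \<subseteq> verts G \<and>
     successively (\<lambda>x y. {x, y} \<in> edges G) xs"

text \<open>The infimum over the empty set is \<open>\<infinity>\<close>: vertices in different components are at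
  infinite distance.\<close>

definition graph_dist :: "'a ugraph \<Rightarrow> 'a \<Rightarrow> 'a \<Rightarrow> enat" where
  "graph_dist G u v = (INF xs \<in> {xs. is_path G u xs v}. enat (length xs - 1))"

definition vdegree :: "'a ugraph \<Rightarrow> 'a \<Rightarrow> nat" where
  "vdegree G v = card {e \<in> edges G. v \<in> e}"

definition degeneracy :: "'a ugraph \<Rightarrow> nat" where
  "degeneracy G =
     (LEAST d. \<forall>H. subgraph H G \<and> verts H \<noteq> {} \<longrightarrow> (\<exists>v\<in>verts H. vdegree H v \<le> d))"

definition is_club :: "nat \<Rightarrow> 'a ugraph \<Rightarrow> 'a set \<Rightarrow> bool" where
  "is_club s G S \<longleftrightarrow>
     S \<subseteq> verts G \<and> (\<forall>u\<in>S. \<forall>v\<in>S. graph_dist (induced_subgraph G S) u v \<le> enat s)"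

definition is_clique :: "nat \<Rightarrow> 'a ugraph \<Rightarrow> 'a set \<Rightarrow> bool" where
  "is_clique s G S \<longleftrightarrow>
     S \<subseteq> verts G \<and> (\<forall>u\<in>S. \<forall>v\<in>S. graph_dist G u v \<le> enat s)"

section \<open>Polynomial time\<close>

text \<open>The machine model is a random access machine, programmed by structured while-programs.
  A state consists of registers and an indirectly addressable memory, both holding natural
  numbers. The arithmetic operations are addition and truncated subtraction only; each operation
  has unit cost. Since there is no multiplication, numbers have at most linearly many bits in the
  input length plus the running time, so polynomial time on this machine is
  polynomial time on a Turing machine.\<close>

datatype expr =
    Const nat
  | Reg nat
  | Mem expr
  | Add expr expr
  | Sub expr expr

datatype prog =
    Skip
  | Assign nat expr
  | Store expr expr
  | Seq prog prog
  | If expr prog prog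
  | While expr prog

record state =
  regs :: "nat \<Rightarrow> nat"
  memory :: "nat \<Rightarrow> nat"

fun eval_expr :: "expr \<Rightarrow> state \<Rightarrow> nat" where
  "eval_expr (Const n) \<sigma> = n"
| "eval_expr (Reg r) \<sigma> = regs \<sigma> r"
| "eval_expr (Mem a) \<sigma> = memory \<sigma> (eval_expr a \<sigma>)"
| "eval_expr (Add a b) \<sigma> = eval_expr a \<sigma> + eval_expr b \<sigma>"
| "eval_expr (Sub a b) \<sigma> = eval_expr a \<sigma> - eval_expr b \<sigma>"

fun cost :: "expr \<Rightarrow> nat" where
  "cost (Const n) = 1"
| "cost (Reg r) = 1"
| "cost (Mem a) = 1 + cost a"
| "cost (Add a b) = 1 + cost a + cost b"
| "cost (Sub a b) = 1 + cost a + cost b"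

text \<open>\<open>exec c \<sigma> t \<tau>\<close>: started in \<open>\<sigma>\<close>, the program \<open>c\<close> halts after \<open>t\<close> steps in \<open>\<tau>\<close>.
  A guard counts as true iff its value is nonzero.\<close>

inductive exec :: "prog \<Rightarrow> state \<Rightarrow> nat \<Rightarrow> state \<Rightarrow> bool" where
  Skip: "exec Skip \<sigma> 1 \<sigma>"
| Assign: "exec (Assign r a) \<sigma> (1 + cost a) (\<sigma>\<lparr>regs := (regs \<sigma>)(r := eval_expr a \<sigma>)\<rparr>)"
| Store: "exec (Store a b) \<sigma> (1 + cost a + cost b)
            (\<sigma>\<lparr>memory := (memory \<sigma>)(eval_expr a \<sigma> := eval_expr b \<sigma>)\<rparr>)"
| Seq: "exec c\<^sub>1 \<sigma> t\<^sub>1 \<tau> \<Longrightarrow> exec c\<^sub>2 \<tau> t\<^sub>2 \<rho> \<Longrightarrow> exec (Seq c\<^sub>1 c\<^sub>2) \<sigma> (t\<^sub>1 + t\<^sub>2) \<rho>"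
| If_True: "eval_expr b \<sigma> \<noteq> 0 \<Longrightarrow> exec c\<^sub>1 \<sigma> t \<tau> \<Longrightarrow> exec (If b c\<^sub>1 c\<^sub>2) \<sigma> (1 + cost b + t) \<tau>"
| If_False: "eval_expr b \<sigma> = 0 \<Longrightarrow> exec c\<^sub>2 \<sigma> t \<tau> \<Longrightarrow> exec (If b c\<^sub>1 c\<^sub>2) \<sigma> (1 + cost b + t) \<tau>"
| While_False: "eval_expr b \<sigma> = 0 \<Longrightarrow> exec (While b c) \<sigma> (1 + cost b) \<sigma>"
| While_True: "eval_expr b \<sigma> \<noteq> 0 \<Longrightarrow> exec c \<sigma> t\<^sub>1 \<tau> \<Longrightarrow> exec (While b c) \<tau> t\<^sub>2 \<rho> \<Longrightarrow>
     exec (While b c) \<sigma> (1 + cost b + t\<^sub>1 + t\<^sub>2) \<rho>"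

lemma exec_deterministic:
  "exec c \<sigma> t \<tau> \<Longrightarrow> exec c \<sigma> t' \<tau>' \<Longrightarrow> t = t' \<and> \<tau> = \<tau>'"
proof (induction arbitrary: t' \<tau>' rule: exec.induct)
  case Skip
  then show ?case by cases auto
next
  case Assign
  then show ?case by cases auto
next
  case Store
  then show ?case by cases auto
next
  case (Seq c\<^sub>1 \<sigma> t\<^sub>1 \<tau> c\<^sub>2 t\<^sub>2 \<rho>)
  from Seq.prems obtain u\<^sub>1 u\<^sub>2 \<upsilon> where
    "exec c\<^sub>1 \<sigma> u\<^sub>1 \<upsilon>" "exec c\<^sub>2 \<upsilon> u\<^sub>2 \<tau>'" "t' = u\<^sub>1 + u\<^sub>2"
    by cases auto
  with Seq.IH(1) [of u\<^sub>1 \<upsilon>] Seq.IH(2) [of u\<^sub>2 \<tau>'] show ?case by simp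
next
  case (If_True b \<sigma> c\<^sub>1 t \<tau> c\<^sub>2)
  from If_True.prems If_True.hyps(1) obtain u where
    "exec c\<^sub>1 \<sigma> u \<tau>'" "t' = 1 + cost b + u"
    by cases auto
  with If_True.IH [of u \<tau>'] show ?case by simp
next
  case (If_False b \<sigma> c\<^sub>2 t \<tau> c\<^sub>1)
  from If_False.prems If_False.hyps(1) obtain u where
    "exec c\<^sub>2 \<sigma> u \<tau>'" "t' = 1 + cost b + u"
    by cases auto
  with If_False.IH [of u \<tau>'] show ?case by simp
next
  case While_False
  from While_False.prems show ?case by cases (use While_False in auto)
next
  case (While_True b \<sigma> c t\<^sub>1 \<tau> t\<^sub>2 \<rho>)
  from While_True.prems While_True.hyps(1) obtain u\<^sub>1 u\<^sub>2 \<upsilon> where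
    "exec c \<sigma> u\<^sub>1 \<upsilon>" "exec (While b c) \<upsilon> u\<^sub>2 \<tau>'" "t' = 1 + cost b + u\<^sub>1 + u\<^sub>2"
    by cases auto
  with While_True.IH(1) [of u\<^sub>1 \<upsilon>] While_True.IH(2) [of u\<^sub>2 \<tau>'] show ?case by simp
qed

text \<open>The input word is placed in memory bit by bit, its length in register 0.\<close>

definition initial_state :: "bool list \<Rightarrow> state" where
  "initial_state w =
     \<lparr>regs = (\<lambda>_. 0)(0 := length w),
      memory = (\<lambda>i. if i < length w then of_bool (w ! i) else 0)\<rparr>"

text \<open>A decision problem \<open>Q\<close> is solved in polynomial time on a class \<open>I\<close> of instances: only
  inputs encoding an instance from \<open>I\<close> have to be answered. The answer is returned in
  register 0.\<close>

definition poly_time_solvable_on :: "('i \<Rightarrow> bool list) \<Rightarrow> 'i set \<Rightarrow> ('i \<Rightarrow> bool) \<Rightarrow> bool" where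
  "poly_time_solvable_on enc I Q \<longleftrightarrow>
     (\<exists>c. \<exists>p :: nat poly. \<forall>x\<in>I. \<exists>t \<tau>.
        exec c (initial_state (enc x)) t \<tau> \<and>
        t \<le> poly p (length (enc x)) \<and>
        regs \<tau> 0 = of_bool (Q x))"

section \<open>The decision problems\<close>

text \<open>An instance is a graph, whose vertices are numbered \<open>0, \<dots>, n - 1\<close>, together with an
  integer.\<close>

type_synonym instance_type = "nat ugraph \<times> int"

definition instances :: "instance_type set" where
  "instances = {(G, k). simple_graph G \<and> verts G = {..<card (verts G)}}"

definition s_club_problem :: "nat \<Rightarrow> instance_type \<Rightarrow> bool" where
  "s_club_problem s = (\<lambda>(G, k). \<exists>S. is_club s G S \<and> int (card S) \<ge> k)"

definition s_clique_problem :: "nat \<Rightarrow> instance_type \<Rightarrow> bool" where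
  "s_clique_problem s = (\<lambda>(G, k). \<exists>S. is_clique s G S \<and> int (card S) \<ge> k)"

text \<open>Binary representation, least significant bit first.\<close>

fun nat_bits :: "nat \<Rightarrow> bool list" where
  "nat_bits n = (if n = 0 then [] else odd n # nat_bits (n div 2))"

declare nat_bits.simps [simp del]

text \<open>The code of \<open>(G, k)\<close>: the number of vertices in unary, a separator, the adjacency matrix
  row by row, the sign of \<open>k\<close>, and \<open>\<bar>k\<bar>\<close> in binary.\<close>

definition encode_instance :: "instance_type \<Rightarrow> bool list" where
  "encode_instance = (\<lambda>(G, k). let n = card (verts G) in
     replicate n True @ [False] @
     concat (map (\<lambda>i. map (\<lambda>j. {i, j} \<in> edges G) [0..<n]) [0..<n]) @
     [k < 0] @ nat_bits (nat \<bar>k\<bar>))"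

end

theory Submission imports Defs begin

text \<open>Distances in a forest satisfy the four-point condition. If \<open>S\<close> is an \<open>s\<close>-clique with
  diametral pair \<open>a, b\<close> and \<open>D = d(a, b) \<le> s\<close>, then \<open>S\<close> is contained in the lens
  \<open>{w. d(w, a) \<le> D \<and> d(w, b) \<le> D}\<close>. By the four-point condition every lens with exactly
  \<open>d(a, b) = D\<close> has diameter at most \<open>D\<close> and is convex, hence is itself an \<open>s\<close>-club. So both problems
  have the same answer, which is found by computing the sizes of all lenses. Since \<open>s\<close> is a
  constant, \<open>d(u, v) \<le> k\<close> for \<open>k \<le> s\<close> can be tested by \<open>k\<close> nested loops over the
  vertices, so that the program never writes to memory.\<close>

section \<open>Functions computable in polynomial time\<close>

text \<open>The obstacle on the graph side is that clubs are not hereditary: a subset of a club may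
  be no club, because distances grow when vertices are removed. Convexity of the lens settles this,
  since no shortest path between two of its members leaves it and the induced distances are those of
  the forest. Distances are handled only through upper bounds, \<open>reach G k u v\<close> meaning
  d(u, v) <= k, so disconnected forests need no infinite values; the lower bound d(a, b) >= D is the
  failure of \<open>reach G (D - 1) a b\<close>. On the machine side one kind of loop is enough,
  running exactly as often as the input is long. It visits every vertex, because the number of
  vertices is encoded in unary and is thus smaller than the input length.\<close>

definition evaluates :: "prog \<Rightarrow> nat \<Rightarrow> state \<Rightarrow> nat \<Rightarrow> nat \<Rightarrow> bool" where
  "evaluates c d \<sigma> T y \<longleftrightarrow>
     (\<exists>t \<tau>. exec c \<sigma> t \<tau> \<and> t \<le> T \<and> memory \<tau> = memory \<sigma> \<and>
        (\<forall>r<d. regs \<tau> r = regs \<sigma> r) \<and> regs \<tau> d = y)"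

lemma evaluates_mono: "evaluates c d \<sigma> T y \<Longrightarrow> T \<le> T' \<Longrightarrow> evaluates c d \<sigma> T' y"
  unfolding evaluates_def using le_trans by blast

lemma evaluatesI:
  assumes "exec c \<sigma> t \<tau>" "t \<le> T" "memory \<tau> = memory \<sigma>" "\<And>r. r < d \<Longrightarrow> regs \<tau> r = regs \<sigma> r"
    "regs \<tau> d = y"
  shows "evaluates c d \<sigma> T y"
  unfolding evaluates_def using assms by blast

lemma evaluates_Assign:
  "eval_expr e \<sigma> = y \<Longrightarrow> 1 + cost e \<le> T \<Longrightarrow> evaluates (Assign d e) d \<sigma> T y"
  by (rule evaluatesI [OF exec.Assign]) auto

text \<open>Registers are used as a stack. The result of the first program sits at level
  \<open>d\<^sub>1\<close>, where the second program can read it; nothing is known about higher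
  registers, so the second program is verified in every state \<open>\<tau>\<close> that agrees with
  \<open>\<sigma>\<close> on the memory and below \<open>d\<^sub>1\<close>.\<close>

lemma evaluates_Seq:
  assumes "evaluates c\<^sub>1 d\<^sub>1 \<sigma> T\<^sub>1 y\<^sub>1" and "d \<le> d\<^sub>1"
    and "\<And>\<tau>. memory \<tau> = memory \<sigma> \<Longrightarrow> \<forall>r<d\<^sub>1. regs \<tau> r = regs \<sigma> r \<Longrightarrow> regs \<tau> d\<^sub>1 = y\<^sub>1 \<Longrightarrow>
           evaluates c\<^sub>2 d \<tau> T\<^sub>2 y"
    and "T\<^sub>1 + T\<^sub>2 \<le> T"
  shows "evaluates (Seq c\<^sub>1 c\<^sub>2) d \<sigma> T y"
proof -
  from assms(1) obtain t\<^sub>1 \<tau> where 1: "exec c\<^sub>1 \<sigma> t\<^sub>1 \<tau>" "t\<^sub>1 \<le> T\<^sub>1" "memory \<tau> = memory \<sigma>"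
    "\<forall>r<d\<^sub>1. regs \<tau> r = regs \<sigma> r" "regs \<tau> d\<^sub>1 = y\<^sub>1"
    unfolding evaluates_def by blast
  from assms(3) [OF 1(3-5)] obtain t\<^sub>2 \<rho> where 2: "exec c\<^sub>2 \<tau> t\<^sub>2 \<rho>" "t\<^sub>2 \<le> T\<^sub>2"
    "memory \<rho> = memory \<tau>" "\<forall>r<d. regs \<rho> r = regs \<tau> r" "regs \<rho> d = y"
    unfolding evaluates_def by blast
  show ?thesis
    by (rule evaluatesI [OF exec.Seq [OF 1(1) 2(1)]]) (use 1 2 assms(2,4) in auto)
qed

lemma evaluates_If:
  assumes "eval_expr b \<sigma> \<noteq> 0 \<Longrightarrow> evaluates c\<^sub>1 d \<sigma> T\<^sub>1 y"
    and "eval_expr b \<sigma> = 0 \<Longrightarrow> evaluates c\<^sub>2 d \<sigma> T\<^sub>1 y"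
    and "1 + cost b + T\<^sub>1 \<le> T"
  shows "evaluates (If b c\<^sub>1 c\<^sub>2) d \<sigma> T y"
proof (cases "eval_expr b \<sigma> = 0")
  case True
  with assms(2) obtain t \<tau> where *: "exec c\<^sub>2 \<sigma> t \<tau>" "t \<le> T\<^sub>1" "memory \<tau> = memory \<sigma>"
    "\<forall>r<d. regs \<tau> r = regs \<sigma> r" "regs \<tau> d = y"
    unfolding evaluates_def by blast
  then show ?thesis
    by (intro evaluatesI [OF exec.If_False [OF True *(1)]]) (use assms(3) in auto)
next
  case False
  with assms(1) obtain t \<tau> where *: "exec c\<^sub>1 \<sigma> t \<tau>" "t \<le> T\<^sub>1" "memory \<tau> = memory \<sigma>"
    "\<forall>r<d. regs \<tau> r = regs \<sigma> r" "regs \<tau> d = y"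
    unfolding evaluates_def by blast
  then show ?thesis
    by (intro evaluatesI [OF exec.If_True [OF False *(1)]]) (use assms(3) in auto)
qed

text \<open>The second argument of \<open>f\<close> is an environment of auxiliary variables, held in the
  registers \<open>rs 0, rs 1, \<dots>\<close>; the value is delivered in register \<open>d\<close>, above all of them, and
  registers above \<open>d\<close> are scratch space. Quantifying over \<open>rs\<close> and \<open>d\<close> makes the class closed
  under composition and renaming of variables.\<close>

definition polyf :: "('x \<Rightarrow> bool list) \<Rightarrow> 'x set \<Rightarrow> ('x \<Rightarrow> (nat \<Rightarrow> nat) \<Rightarrow> nat) \<Rightarrow> bool" where
  "polyf enc I f \<longleftrightarrow>
     (\<forall>rs d. (\<forall>k. rs k < d) \<longrightarrow>
       (\<exists>c. \<exists>p :: nat poly. \<forall>x\<in>I. \<forall>\<sigma>.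
          memory \<sigma> = memory (initial_state (enc x)) \<longrightarrow> regs \<sigma> 0 = length (enc x) \<longrightarrow>
          evaluates c d \<sigma> (poly p (length (enc x))) (f x (\<lambda>k. regs \<sigma> (rs k)))))"

context
  fixes enc :: "'x \<Rightarrow> bool list" and I :: "'x set"
begin

lemma polyfE:
  assumes "polyf enc I f" "\<forall>k. rs k < d"
  obtains c p where "\<And>x \<sigma>. x \<in> I \<Longrightarrow> memory \<sigma> = memory (initial_state (enc x)) \<Longrightarrow>
    regs \<sigma> 0 = length (enc x) \<Longrightarrow>
    evaluates c d \<sigma> (poly p (length (enc x))) (f x (\<lambda>k. regs \<sigma> (rs k)))"
  using assms unfolding polyf_def by meson

lemma polyfI:
  assumes "\<And>rs d. \<forall>k. rs k < d \<Longrightarrow>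
    \<exists>c. \<exists>p :: nat poly. \<forall>x\<in>I. \<forall>\<sigma>.
      memory \<sigma> = memory (initial_state (enc x)) \<longrightarrow> regs \<sigma> 0 = length (enc x) \<longrightarrow>
      evaluates c d \<sigma> (poly p (length (enc x))) (f x (\<lambda>k. regs \<sigma> (rs k)))"
  shows "polyf enc I f"
  using assms unfolding polyf_def by blast

lemma polyf_cong:
  assumes "polyf enc I f" "\<And>x \<rho>. x \<in> I \<Longrightarrow> f x \<rho> = g x \<rho>"
  shows "polyf enc I g"
  using assms unfolding polyf_def by simp

text \<open>Renaming costs no instruction: it only replaces the register assignment
  \<open>rs\<close> by \<open>rs\<close> after \<open>h\<close>. With \<open>h = Suc\<close> it
  serves as weakening below a bound variable, variable 0 being the innermost one.\<close>

lemma polyf_rename: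
  assumes "polyf enc I f"
  shows "polyf enc I (\<lambda>x \<rho>. f x (\<lambda>k. \<rho> (h k)))"
proof (rule polyfI)
  fix rs :: "nat \<Rightarrow> nat" and d
  assume "\<forall>k. rs k < d"
  then have "\<forall>k. rs (h k) < d" by simp
  from polyfE [OF assms this] obtain c p where "\<And>x \<sigma>. x \<in> I \<Longrightarrow>
    memory \<sigma> = memory (initial_state (enc x)) \<Longrightarrow> regs \<sigma> 0 = length (enc x) \<Longrightarrow>
    evaluates c d \<sigma> (poly p (length (enc x))) (f x (\<lambda>k. regs \<sigma> (rs (h k))))" by blast
  then show "\<exists>c. \<exists>p :: nat poly. \<forall>x\<in>I. \<forall>\<sigma>.
      memory \<sigma> = memory (initial_state (enc x)) \<longrightarrow> regs \<sigma> 0 = length (enc x) \<longrightarrow>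
      evaluates c d \<sigma> (poly p (length (enc x))) (f x (\<lambda>k. regs \<sigma> (rs (h k))))"
    by blast
qed

section \<open>Basic functions, arithmetic and case distinction\<close>

lemma polyf_expr:
  assumes "\<And>rs d. \<forall>k. rs k < d \<Longrightarrow> \<exists>e. \<forall>x\<in>I. \<forall>\<sigma>.
      memory \<sigma> = memory (initial_state (enc x)) \<longrightarrow> regs \<sigma> 0 = length (enc x) \<longrightarrow>
      eval_expr e \<sigma> = f x (\<lambda>k. regs \<sigma> (rs k))"
  shows "polyf enc I f"
proof (rule polyfI)
  fix rs :: "nat \<Rightarrow> nat" and d
  assume "\<forall>k. rs k < d"
  from assms [OF this] obtain e where e: "\<forall>x\<in>I. \<forall>\<sigma>.
      memory \<sigma> = memory (initial_state (enc x)) \<longrightarrow> regs \<sigma> 0 = length (enc x) \<longrightarrow>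
      eval_expr e \<sigma> = f x (\<lambda>k. regs \<sigma> (rs k))" by blast
  show "\<exists>c. \<exists>p :: nat poly. \<forall>x\<in>I. \<forall>\<sigma>.
      memory \<sigma> = memory (initial_state (enc x)) \<longrightarrow> regs \<sigma> 0 = length (enc x) \<longrightarrow>
      evaluates c d \<sigma> (poly p (length (enc x))) (f x (\<lambda>k. regs \<sigma> (rs k)))"
    by (rule exI [of _ "Assign d e"], rule exI [of _ "[:1 + cost e:]"])
      (use e in \<open>auto intro!: evaluates_Assign\<close>)
qed

lemma polyf_const: "polyf enc I (\<lambda>x \<rho>. m)"
  by (rule polyf_expr) (auto intro: exI [of _ "Const m"])

lemma polyf_length: "polyf enc I (\<lambda>x \<rho>. length (enc x))"
  by (rule polyf_expr) (auto intro: exI [of _ "Reg 0"])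

lemma polyf_var: "polyf enc I (\<lambda>x \<rho>. \<rho> k)"
proof (rule polyf_expr)
  fix rs :: "nat \<Rightarrow> nat"
  show "\<exists>e. \<forall>x\<in>I. \<forall>\<sigma>. memory \<sigma> = memory (initial_state (enc x)) \<longrightarrow>
      regs \<sigma> 0 = length (enc x) \<longrightarrow> eval_expr e \<sigma> = regs \<sigma> (rs k)"
    by (rule exI [of _ "Reg (rs k)"]) simp
qed

text \<open>The value of \<open>f\<close> is parked in register \<open>d\<close> while
  \<open>g\<close> is computed with target \<open>Suc d\<close>; one expression then combines the
  two. Letting \<open>h\<close> depend on \<open>x\<close> also covers reads of the memory, which
  still holds the input.\<close>

lemma polyf_binop:
  assumes f: "polyf enc I f" and g: "polyf enc I g"
    and e: "\<And>x d \<sigma>. x \<in> I \<Longrightarrow> memory \<sigma> = memory (initial_state (enc x)) \<Longrightarrow>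
      eval_expr (e d) (\<sigma> :: state) = h x (regs \<sigma> d) (regs \<sigma> (Suc d))"
  shows "polyf enc I (\<lambda>x \<rho>. h x (f x \<rho>) (g x \<rho>))"
proof (rule polyfI)
  fix rs :: "nat \<Rightarrow> nat" and d
  assume rs: "\<forall>k. rs k < d"
  \<comment> \<open>Register 0 lies below the target, hence every subprogram preserves the input
    length stored there.\<close>
  then have d: "0 < d" by (metis not_less_zero gr_zeroI)
  from rs have rs': "\<forall>k. rs k < Suc d" using less_SucI by blast
  from polyfE [OF f rs] obtain c p where c: "\<And>x \<sigma>. x \<in> I \<Longrightarrow>
    memory \<sigma> = memory (initial_state (enc x)) \<Longrightarrow> regs \<sigma> 0 = length (enc x) \<Longrightarrow>
    evaluates c d \<sigma> (poly p (length (enc x))) (f x (\<lambda>k. regs \<sigma> (rs k)))" by blast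
  from polyfE [OF g rs'] obtain c' p' where c': "\<And>x \<sigma>. x \<in> I \<Longrightarrow>
    memory \<sigma> = memory (initial_state (enc x)) \<Longrightarrow> regs \<sigma> 0 = length (enc x) \<Longrightarrow>
    evaluates c' (Suc d) \<sigma> (poly p' (length (enc x))) (g x (\<lambda>k. regs \<sigma> (rs k)))" by blast
  show "\<exists>c. \<exists>p :: nat poly. \<forall>x\<in>I. \<forall>\<sigma>.
      memory \<sigma> = memory (initial_state (enc x)) \<longrightarrow> regs \<sigma> 0 = length (enc x) \<longrightarrow>
      evaluates c d \<sigma> (poly p (length (enc x)))
        (h x (f x (\<lambda>k. regs \<sigma> (rs k))) (g x (\<lambda>k. regs \<sigma> (rs k))))"
  proof (intro exI ballI allI impI)
    fix x and \<sigma> :: state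
    assume x: "x \<in> I" and \<sigma>: "memory \<sigma> = memory (initial_state (enc x))" "regs \<sigma> 0 = length (enc x)"
    show "evaluates (Seq c (Seq c' (Assign d (e d)))) d \<sigma>
        (poly (p + (p' + [:1 + cost (e d):])) (length (enc x)))
        (h x (f x (\<lambda>k. regs \<sigma> (rs k))) (g x (\<lambda>k. regs \<sigma> (rs k))))"
    proof (rule evaluates_Seq [OF c [OF x \<sigma>] order_refl])
      fix \<tau> :: state
      assume \<tau>: "memory \<tau> = memory \<sigma>" "\<forall>r<d. regs \<tau> r = regs \<sigma> r"
        "regs \<tau> d = f x (\<lambda>k. regs \<sigma> (rs k))"
      have "evaluates c' (Suc d) \<tau> (poly p' (length (enc x))) (g x (\<lambda>k. regs \<tau> (rs k)))"
        by (rule c' [OF x]) (use \<sigma> \<tau> d in auto)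
      also have "(\<lambda>k. regs \<tau> (rs k)) = (\<lambda>k. regs \<sigma> (rs k))" using \<tau>(2) rs by auto
      finally show "evaluates (Seq c' (Assign d (e d))) d \<tau>
          (poly (p' + [:1 + cost (e d):]) (length (enc x)))
          (h x (f x (\<lambda>k. regs \<sigma> (rs k))) (g x (\<lambda>k. regs \<sigma> (rs k))))"
        by (rule evaluates_Seq) (use \<sigma> \<tau> in \<open>auto intro!: evaluates_Assign simp: e [OF x]\<close>)
    qed simp
  qed
qed

lemma polyf_add:
  assumes "polyf enc I f" "polyf enc I g"
  shows "polyf enc I (\<lambda>x \<rho>. f x \<rho> + g x \<rho>)"
  by (rule polyf_binop [OF assms, where e = "\<lambda>d. Add (Reg d) (Reg (Suc d))"]) simp

lemma polyf_diff:
  assumes "polyf enc I f" "polyf enc I g"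
  shows "polyf enc I (\<lambda>x \<rho>. f x \<rho> - g x \<rho>)"
  by (rule polyf_binop [OF assms, where e = "\<lambda>d. Sub (Reg d) (Reg (Suc d))"]) simp

lemma polyf_input:
  assumes "polyf enc I f"
  shows "polyf enc I (\<lambda>x \<rho>. of_bool (f x \<rho> < length (enc x) \<and> enc x ! f x \<rho>))"
  \<comment> \<open>Memory beyond the input word holds 0, which is also the value of the failed
    range test.\<close>
  by (rule polyf_cong, rule polyf_binop [OF assms assms, where e = "\<lambda>d. Mem (Reg d)" and
      h = "\<lambda>x m _. memory (initial_state (enc x)) m"])
    (simp_all add: initial_state_def)

lemma polyf_if_of_bool:
  assumes b: "polyf enc I (\<lambda>x \<rho>. of_bool (P x \<rho>))" and f: "polyf enc I f" and g: "polyf enc I g"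
  shows "polyf enc I (\<lambda>x \<rho>. if P x \<rho> then f x \<rho> else g x \<rho>)"
proof (rule polyfI)
  fix rs :: "nat \<Rightarrow> nat" and d
  assume rs: "\<forall>k. rs k < d"
  then have d: "0 < d" by (metis not_less_zero gr_zeroI)
  from polyfE [OF b rs] obtain c p where c: "\<And>x \<sigma>. x \<in> I \<Longrightarrow>
    memory \<sigma> = memory (initial_state (enc x)) \<Longrightarrow> regs \<sigma> 0 = length (enc x) \<Longrightarrow>
    evaluates c d \<sigma> (poly p (length (enc x))) (of_bool (P x (\<lambda>k. regs \<sigma> (rs k))))" by blast
  from polyfE [OF f rs] obtain c\<^sub>1 p\<^sub>1 where c1: "\<And>x \<sigma>. x \<in> I \<Longrightarrow>
    memory \<sigma> = memory (initial_state (enc x)) \<Longrightarrow> regs \<sigma> 0 = length (enc x) \<Longrightarrow>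
    evaluates c\<^sub>1 d \<sigma> (poly p\<^sub>1 (length (enc x))) (f x (\<lambda>k. regs \<sigma> (rs k)))" by blast
  from polyfE [OF g rs] obtain c\<^sub>2 p\<^sub>2 where c2: "\<And>x \<sigma>. x \<in> I \<Longrightarrow>
    memory \<sigma> = memory (initial_state (enc x)) \<Longrightarrow> regs \<sigma> 0 = length (enc x) \<Longrightarrow>
    evaluates c\<^sub>2 d \<sigma> (poly p\<^sub>2 (length (enc x))) (g x (\<lambda>k. regs \<sigma> (rs k)))" by blast
  show "\<exists>c. \<exists>p :: nat poly. \<forall>x\<in>I. \<forall>\<sigma>.
      memory \<sigma> = memory (initial_state (enc x)) \<longrightarrow> regs \<sigma> 0 = length (enc x) \<longrightarrow>
      evaluates c d \<sigma> (poly p (length (enc x)))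
        (if P x (\<lambda>k. regs \<sigma> (rs k)) then f x (\<lambda>k. regs \<sigma> (rs k)) else g x (\<lambda>k. regs \<sigma> (rs k)))"
  proof (intro exI ballI allI impI)
    fix x and \<sigma> :: state
    assume x: "x \<in> I" and \<sigma>: "memory \<sigma> = memory (initial_state (enc x))" "regs \<sigma> 0 = length (enc x)"
    let ?y = "if P x (\<lambda>k. regs \<sigma> (rs k)) then f x (\<lambda>k. regs \<sigma> (rs k)) else g x (\<lambda>k. regs \<sigma> (rs k))"
    show "evaluates (Seq c (If (Reg d) c\<^sub>1 c\<^sub>2)) d \<sigma>
        (poly (p + (p\<^sub>1 + p\<^sub>2 + [:2:])) (length (enc x))) ?y"
    proof (rule evaluates_Seq [OF c [OF x \<sigma>] order_refl])
      fix \<tau> :: state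
      assume \<tau>: "memory \<tau> = memory \<sigma>" "\<forall>r<d. regs \<tau> r = regs \<sigma> r"
        "regs \<tau> d = of_bool (P x (\<lambda>k. regs \<sigma> (rs k)))"
      have eq: "(\<lambda>k. regs \<tau> (rs k)) = (\<lambda>k. regs \<sigma> (rs k))" using \<tau>(2) rs by auto
      have "evaluates c\<^sub>1 d \<tau> (poly p\<^sub>1 (length (enc x))) (f x (\<lambda>k. regs \<tau> (rs k)))"
        by (rule c1 [OF x]) (use \<sigma> \<tau> d in auto)
      moreover have "evaluates c\<^sub>2 d \<tau> (poly p\<^sub>2 (length (enc x))) (g x (\<lambda>k. regs \<tau> (rs k)))"
        by (rule c2 [OF x]) (use \<sigma> \<tau> d in auto)
      ultimately show "evaluates (If (Reg d) c\<^sub>1 c\<^sub>2) d \<tau>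
          (poly (p\<^sub>1 + p\<^sub>2 + [:2:]) (length (enc x))) ?y"
        unfolding eq using \<tau>(3)
        \<comment> \<open>Either branch runs within the sum of both bounds, so the time bound does
          not depend on the outcome of the test.\<close>
        by (intro evaluates_If [where T\<^sub>1 = "poly p\<^sub>1 (length (enc x)) + poly p\<^sub>2 (length (enc x))"])
          (simp_all add: evaluates_mono split: if_splits)
    qed simp
  qed
qed

text \<open>The accumulator is kept in register \<open>d\<close>, the counter in
  \<open>Suc d\<close>, and the next accumulator is computed in \<open>Suc (Suc d)\<close>. The
  polynomial for \<open>g\<close> is uniform in the register contents, so even an accumulator that
  doubles in every round leaves the total time polynomial.\<close>

lemma polyf_rec:
  assumes g: "polyf enc I (\<lambda>x \<rho>. g x (\<rho> 0) (\<rho> 1) (\<lambda>k. \<rho> (Suc (Suc k))))"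
  shows "polyf enc I (\<lambda>x \<rho>. rec_nat 0 (\<lambda>i a. g x i a \<rho>) (length (enc x)))"
proof (rule polyfI)
  fix rs :: "nat \<Rightarrow> nat" and d
  assume rs: "\<forall>k. rs k < d"
  then have d: "0 < d" by (metis not_less_zero gr_zeroI)
  define rs' where "rs' = case_nat (Suc d) (case_nat d rs)"
  have "\<forall>k. rs' k < Suc (Suc d)"
    unfolding rs'_def using rs by (auto split: nat.split intro: less_SucI)
  from polyfE [OF g this] obtain c p where c: "\<And>x \<sigma>. x \<in> I \<Longrightarrow>
    memory \<sigma> = memory (initial_state (enc x)) \<Longrightarrow> regs \<sigma> 0 = length (enc x) \<Longrightarrow>
    evaluates c (Suc (Suc d)) \<sigma> (poly p (length (enc x)))
      (g x (regs \<sigma> (Suc d)) (regs \<sigma> d) (\<lambda>k. regs \<sigma> (rs k)))"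
    by (auto simp: rs'_def)
  define body where "body = Seq c (Seq (Assign d (Reg (Suc (Suc d))))
      (Assign (Suc d) (Add (Reg (Suc d)) (Const 1))))"
  define loop where "loop = While (Sub (Reg 0) (Reg (Suc d))) body"
  \<comment> \<open>Here \<open>m\<close> counts the rounds still to come. The overhead 10 of a
    round is 4 for the guard, 2 for copying and 4 for the increment; the final 4 is the failing
    guard.\<close>
  have loop: "evaluates loop d \<sigma> (m * (poly p (length (enc x)) + 10) + 4)
        (rec_nat 0 (\<lambda>i a. g x i a \<rho>) (length (enc x)))"
    if "x \<in> I" "memory \<sigma> = memory (initial_state (enc x))" "regs \<sigma> 0 = length (enc x)"
      "(\<lambda>k. regs \<sigma> (rs k)) = \<rho>" "m \<le> length (enc x)" "regs \<sigma> (Suc d) = length (enc x) - m"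
      "regs \<sigma> d = rec_nat 0 (\<lambda>i a. g x i a \<rho>) (length (enc x) - m)" for x \<sigma> m \<rho>
    using that
  proof (induction m arbitrary: \<sigma>)
    case 0
    then show ?case
      unfolding loop_def by (intro evaluatesI [OF exec.While_False]) auto
  next
    case (Suc m)
    let ?L = "length (enc x)"
    from c [OF Suc.prems(1-3)] obtain t \<tau> where \<tau>: "exec c \<sigma> t \<tau>" "t \<le> poly p ?L"
      "memory \<tau> = memory \<sigma>" "\<forall>r<Suc (Suc d). regs \<tau> r = regs \<sigma> r"
      "regs \<tau> (Suc (Suc d)) = g x (regs \<sigma> (Suc d)) (regs \<sigma> d) \<rho>"
      unfolding evaluates_def Suc.prems(4) by blast
    let ?\<tau>1 = "\<tau>\<lparr>regs := (regs \<tau>)(d := regs \<tau> (Suc (Suc d)))\<rparr>"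
    let ?\<tau>2 = "?\<tau>1\<lparr>regs := (regs ?\<tau>1)(Suc d := regs ?\<tau>1 (Suc d) + 1)\<rparr>"
    have "exec body \<sigma> (t + (2 + 4)) ?\<tau>2"
      unfolding body_def
      using exec.Seq [OF \<tau>(1) exec.Seq [OF exec.Assign exec.Assign],
          of d "Reg (Suc (Suc d))" "Suc d" "Add (Reg (Suc d)) (Const 1)"]
      by (simp add: numeral_eq_Suc)
    moreover
    have 1: "?L - m = Suc (?L - Suc m)" using Suc.prems(5) by simp
    have "evaluates loop d ?\<tau>2 (m * (poly p ?L + 10) + 4) (rec_nat 0 (\<lambda>i a. g x i a \<rho>) ?L)"
    proof (rule Suc.IH)
      show "(\<lambda>k. regs ?\<tau>2 (rs k)) = \<rho>"
        using \<tau>(4) rs Suc.prems(4) less_SucI by (fastforce simp: less_Suc_eq)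
      show "regs ?\<tau>2 d = rec_nat 0 (\<lambda>i a. g x i a \<rho>) (?L - m)"
        unfolding 1 using \<tau>(5) Suc.prems(6,7) by simp
      show "regs ?\<tau>2 (Suc d) = ?L - m"
        unfolding 1 using \<tau>(4) Suc.prems(6) by simp
    qed (use Suc.prems \<tau> d in auto)
    then obtain t' \<upsilon> where \<upsilon>: "exec loop ?\<tau>2 t' \<upsilon>" "t' \<le> m * (poly p ?L + 10) + 4"
      "memory \<upsilon> = memory ?\<tau>2" "\<forall>r<d. regs \<upsilon> r = regs ?\<tau>2 r"
      "regs \<upsilon> d = rec_nat 0 (\<lambda>i a. g x i a \<rho>) ?L"
      unfolding evaluates_def by blast
    have "exec loop \<sigma> (1 + cost (Sub (Reg 0) (Reg (Suc d))) + (t + (2 + 4)) + t') \<upsilon>"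
      unfolding loop_def
    proof (rule exec.While_True)
      show "eval_expr (Sub (Reg 0) (Reg (Suc d))) \<sigma> \<noteq> 0" using Suc.prems by simp
    qed (use calculation \<upsilon>(1) in \<open>simp_all add: loop_def\<close>)
    then show ?case
      by (rule evaluatesI) (use \<tau> \<upsilon> in auto)
  qed
  show "\<exists>c. \<exists>p :: nat poly. \<forall>x\<in>I. \<forall>\<sigma>.
      memory \<sigma> = memory (initial_state (enc x)) \<longrightarrow> regs \<sigma> 0 = length (enc x) \<longrightarrow>
      evaluates c d \<sigma> (poly p (length (enc x)))
        (rec_nat 0 (\<lambda>i a. g x i a (\<lambda>k. regs \<sigma> (rs k))) (length (enc x)))"
  proof (intro exI ballI allI impI)
    fix x and \<sigma> :: state
    assume x: "x \<in> I" and \<sigma>: "memory \<sigma> = memory (initial_state (enc x))" "regs \<sigma> 0 = length (enc x)"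
    let ?L = "length (enc x)" and ?\<rho> = "\<lambda>k. regs \<sigma> (rs k)"
    have "evaluates (Seq (Assign d (Const 0)) (Seq (Assign (Suc d) (Const 0)) loop)) d \<sigma>
        (2 + (2 + (?L * (poly p ?L + 10) + 4))) (rec_nat 0 (\<lambda>i a. g x i a ?\<rho>) ?L)"
    proof (rule evaluates_Seq)
      show "evaluates (Assign d (Const 0)) d \<sigma> 2 0" by (rule evaluates_Assign) auto
      fix \<tau> :: state
      assume \<tau>: "memory \<tau> = memory \<sigma>" "\<forall>r<d. regs \<tau> r = regs \<sigma> r" "regs \<tau> d = 0"
      show "evaluates (Seq (Assign (Suc d) (Const 0)) loop) d \<tau> (2 + (?L * (poly p ?L + 10) + 4))
          (rec_nat 0 (\<lambda>i a. g x i a ?\<rho>) ?L)"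
      proof (rule evaluates_Seq)
        show "evaluates (Assign (Suc d) (Const 0)) (Suc d) \<tau> 2 0" by (rule evaluates_Assign) auto
        fix \<upsilon> :: state
        assume \<upsilon>: "memory \<upsilon> = memory \<tau>" "\<forall>r<Suc d. regs \<upsilon> r = regs \<tau> r" "regs \<upsilon> (Suc d) = 0"
        have "(\<lambda>k. regs \<upsilon> (rs k)) = ?\<rho>" using \<tau>(2) \<upsilon>(2) rs less_SucI by metis
        then show "evaluates loop d \<upsilon> (?L * (poly p ?L + 10) + 4)
            (rec_nat 0 (\<lambda>i a. g x i a ?\<rho>) ?L)"
          using loop [of x \<upsilon> ?\<rho> ?L] x \<sigma> \<tau> \<upsilon> d by auto
      qed auto
    qed auto
    then show "evaluates (Seq (Assign d (Const 0)) (Seq (Assign (Suc d) (Const 0)) loop)) d \<sigma>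
        (poly ([:0, 1:] * (p + [:10:]) + [:8:]) ?L) (rec_nat 0 (\<lambda>i a. g x i a ?\<rho>) ?L)"
      by (simp add: algebra_simps)
  qed
qed

section \<open>Sums over all positions of the input\<close>

lemma polyf_sum:
  assumes "polyf enc I (\<lambda>x \<rho>. g x (\<rho> 0) (\<lambda>k. \<rho> (Suc k)))"
  shows "polyf enc I (\<lambda>x \<rho>. \<Sum>i<length (enc x). g x i \<rho>)"
proof (rule polyf_cong)
  \<comment> \<open>The renaming inserts a slot for the accumulator as variable 1, between the
    counter and the old environment.\<close>
  have "polyf enc I (\<lambda>x \<rho>. g x (\<rho> 0) (\<lambda>k. \<rho> (Suc (Suc k))))"
    using polyf_rename [OF assms, of "case_nat 0 (\<lambda>k. Suc (Suc k))"] by simp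
  from polyf_add [OF polyf_var [of 1] this]
  show "polyf enc I (\<lambda>x \<rho>. rec_nat 0 (\<lambda>i a. a + g x i \<rho>) (length (enc x)))"
    by (rule polyf_rec)
  have "rec_nat 0 (\<lambda>i a. a + g x i \<rho>) m = (\<Sum>i<m. g x i \<rho>)" for x \<rho> m
    by (induction m) auto
  then show "rec_nat 0 (\<lambda>i a. a + g x i \<rho>) (length (enc x)) = (\<Sum>i<length (enc x). g x i \<rho>)"
    for x \<rho> .
qed

section \<open>Decidable predicates, bounded search and counting\<close>

definition polyp :: "('x \<Rightarrow> (nat \<Rightarrow> nat) \<Rightarrow> bool) \<Rightarrow> bool" where
  "polyp P \<longleftrightarrow> polyf enc I (\<lambda>x \<rho>. of_bool (P x \<rho>))"

lemma polyp_cong: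
  assumes "polyp P" "\<And>x \<rho>. x \<in> I \<Longrightarrow> P x \<rho> \<longleftrightarrow> Q x \<rho>"
  shows "polyp Q"
  using assms unfolding polyp_def by (auto elim: polyf_cong)

lemma polyp_nonzero: "polyf enc I f \<Longrightarrow> polyp (\<lambda>x \<rho>. 0 < f x \<rho>)"
  unfolding polyp_def
  \<comment> \<open>With truncated subtraction, \<open>1 - (1 - m)\<close> is 1 for positive
    \<open>m\<close> and 0 for \<open>m = 0\<close>.\<close>
  by (rule polyf_cong, rule polyf_diff [OF polyf_const [of 1] polyf_diff [OF polyf_const [of 1]]])
    auto

lemma polyp_not: "polyp P \<Longrightarrow> polyp (\<lambda>x \<rho>. \<not> P x \<rho>)"
  unfolding polyp_def
  by (rule polyf_cong, rule polyf_diff [OF polyf_const [of 1]]) auto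

lemma polyp_conj: "polyp P \<Longrightarrow> polyp Q \<Longrightarrow> polyp (\<lambda>x \<rho>. P x \<rho> \<and> Q x \<rho>)"
  unfolding polyp_def
  by (rule polyf_cong, rule polyf_if_of_bool [of P "\<lambda>x \<rho>. of_bool (Q x \<rho>)", OF _ _ polyf_const [of 0]]) auto

lemma polyp_disj: "polyp P \<Longrightarrow> polyp Q \<Longrightarrow> polyp (\<lambda>x \<rho>. P x \<rho> \<or> Q x \<rho>)"
  unfolding polyp_def
  by (rule polyf_cong, rule polyf_if_of_bool [of P _ "\<lambda>x \<rho>. of_bool (Q x \<rho>)", OF _ polyf_const [of 1]]) auto

lemma polyp_less: "polyf enc I f \<Longrightarrow> polyf enc I g \<Longrightarrow> polyp (\<lambda>x \<rho>. f x \<rho> < g x \<rho>)"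
  by (rule polyp_cong, rule polyp_nonzero, rule polyf_diff [of g f]) auto

lemma polyp_le: "polyf enc I f \<Longrightarrow> polyf enc I g \<Longrightarrow> polyp (\<lambda>x \<rho>. f x \<rho> \<le> g x \<rho>)"
  by (rule polyp_cong, rule polyp_not, rule polyp_less [of g f]) auto

lemma polyp_eq: "polyf enc I f \<Longrightarrow> polyf enc I g \<Longrightarrow> polyp (\<lambda>x \<rho>. f x \<rho> = g x \<rho>)"
  by (rule polyp_cong, rule polyp_conj, rule polyp_le [of f g], assumption+,
      rule polyp_le [of g f]) auto

lemma polyp_const: "polyp (\<lambda>x \<rho>. b)"
  unfolding polyp_def by (rule polyf_const)

lemma polyf_If: "polyp P \<Longrightarrow> polyf enc I f \<Longrightarrow> polyf enc I g \<Longrightarrow>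
    polyf enc I (\<lambda>x \<rho>. if P x \<rho> then f x \<rho> else g x \<rho>)"
  unfolding polyp_def by (rule polyf_if_of_bool)

text \<open>Search is reduced to counting: the sum of the truth values is positive iff there is a
  witness.\<close>

lemma polyp_ex:
  assumes "polyp (\<lambda>x \<rho>. P x (\<rho> 0) (\<lambda>k. \<rho> (Suc k)))"
  shows "polyp (\<lambda>x \<rho>. \<exists>i<length (enc x). P x i \<rho>)"
  by (rule polyp_cong, rule polyp_nonzero, rule polyf_sum [where g = "\<lambda>x i \<rho>. of_bool (P x i \<rho>)"])
    (use assms in \<open>auto simp: polyp_def card_gt_0_iff\<close>)

lemma polyf_card:
  assumes "polyp (\<lambda>x \<rho>. P x (\<rho> 0) (\<lambda>k. \<rho> (Suc k)))"
  shows "polyf enc I (\<lambda>x \<rho>. card {i. i < length (enc x) \<and> P x i \<rho>})"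
proof (rule polyf_cong, rule polyf_sum)
  show "polyf enc I (\<lambda>x \<rho>. of_bool (P x (\<rho> 0) (\<lambda>k. \<rho> (Suc k))))"
    using assms by (simp add: polyp_def)
  show "(\<Sum>i<length (enc x). of_bool (P x i \<rho>)) = card {i. i < length (enc x) \<and> P x i \<rho>}"
    for x \<rho> by (simp add: Int_def)
qed

text \<open>Since \<open>s\<close> is a constant, the search is unrolled in the program text. Unlike
  in \<open>polyp_ex\<close>, each \<open>P D\<close> may therefore have its own program and its own
  polynomial.\<close>

lemma polyp_ex_le:
  fixes s :: nat
  assumes "\<And>D. polyp (P D)"
  shows "polyp (\<lambda>x \<rho>. \<exists>D\<le>s. P D x \<rho>)"
proof (induction s)
  case 0
  then show ?case using assms [of 0] by simp
next
  case (Suc s)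
  show ?case by (rule polyp_cong, rule polyp_disj [OF Suc assms [of "Suc s"]]) (auto simp: le_Suc_eq)
qed

lemma polyp_solvable:
  assumes "polyp (\<lambda>x \<rho>. Q x)"
  shows "poly_time_solvable_on enc I Q"
proof -
  \<comment> \<open>The predicate depends on no variable, so all of them may be placed in register
    0. The target is then register 1, and the answer has to be moved to register 0 at the
    end.\<close>
  have "\<forall>k :: nat. (\<lambda>k. 0) k < Suc 0" by simp
  from polyfE [OF assms [unfolded polyp_def] this] obtain c p where
    c: "\<And>x \<sigma>. x \<in> I \<Longrightarrow> memory \<sigma> = memory (initial_state (enc x)) \<Longrightarrow>
      regs \<sigma> 0 = length (enc x) \<Longrightarrow>
      evaluates c (Suc 0) \<sigma> (poly p (length (enc x))) (of_bool (Q x))" by blast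
  show ?thesis
    unfolding poly_time_solvable_on_def
  proof (intro exI [of _ "Seq c (Assign 0 (Reg 1))"] exI [of _ "p + [:2:]"] ballI)
    fix x assume "x \<in> I"
    from c [OF this, of "initial_state (enc x)"] have
      "evaluates c (Suc 0) (initial_state (enc x)) (poly p (length (enc x))) (of_bool (Q x))"
      by (simp add: initial_state_def)
    then have "evaluates (Seq c (Assign 0 (Reg 1))) 0 (initial_state (enc x))
        (poly (p + [:2:]) (length (enc x))) (of_bool (Q x))"
      by (rule evaluates_Seq) (auto intro: evaluates_Assign)
    then show "\<exists>t \<tau>. exec (Seq c (Assign 0 (Reg 1))) (initial_state (enc x)) t \<tau> \<and>
        t \<le> poly (p + [:2:]) (length (enc x)) \<and> regs \<tau> 0 = of_bool (Q x)"
      unfolding evaluates_def by blast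
  qed
qed

end

section \<open>Walks\<close>

text \<open>Walks of length at most \<open>k\<close>. Stopping early is allowed, which gives
  monotonicity in \<open>k\<close>, and the recursion is a nest of \<open>k\<close> vertex
  quantifiers, the form that a program can follow. \<open>reach G k u u\<close> holds even if
  \<open>u\<close> is no vertex.\<close>

fun reach :: "'a ugraph \<Rightarrow> nat \<Rightarrow> 'a \<Rightarrow> 'a \<Rightarrow> bool" where
  "reach G 0 u v \<longleftrightarrow> u = v"
| "reach G (Suc k) u v \<longleftrightarrow> u = v \<or> (\<exists>w. {u, w} \<in> edges G \<and> reach G k w v)"

lemma reach_refl [simp]: "reach G k u u"
  by (cases k) auto

lemma reach_mono: "reach G k u v \<Longrightarrow> k \<le> l \<Longrightarrow> reach G l u v"
proof (induction k arbitrary: u l)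
  case (Suc k)
  then show ?case by (cases l) auto
qed simp

lemma reach_trans: "reach G k u v \<Longrightarrow> reach G l v w \<Longrightarrow> reach G (k + l) u w"
proof (induction k arbitrary: u)
  case (Suc k)
  then show ?case using reach_mono [of G l u w "Suc (k + l)"] by auto
qed simp

lemma reach_edge: "{u, v} \<in> edges G \<Longrightarrow> reach G 1 u v"
  by auto

lemma reach_sym: "reach G k u v \<Longrightarrow> reach G k v u"
proof (induction k arbitrary: u)
  case (Suc k)
  show ?case
  proof (cases "u = v")
    case False
    with Suc.prems obtain w where "{u, w} \<in> edges G" "reach G k w v" by auto
    then show ?thesis
      using reach_trans [OF Suc.IH reach_edge, of w u] by (simp add: insert_commute del: reach.simps)
  qed simp
qed simp

lemma reach_subgraph: "reach H k u v \<Longrightarrow> edges H \<subseteq> edges G \<Longrightarrow> reach G k u v"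
  by (induction k arbitrary: u) auto

lemma simple_graph_edge:
  assumes "simple_graph G" "{u, v} \<in> edges G"
  shows "u \<in> verts G" "v \<in> verts G" "u \<noteq> v"
  using assms unfolding simple_graph_def by fastforce+

section \<open>Walks, simple paths and the distance\<close>

lemma is_path_imp_reach: "is_path G u xs v \<Longrightarrow> reach G (length xs - 1) u v"
proof (induction xs arbitrary: u)
  case (Cons x xs)
  show ?case
  proof (cases xs)
    case Nil
    with Cons.prems show ?thesis by (auto simp: is_path_def)
  next
    case (Cons y ys)
    with Cons.prems have "{u, y} \<in> edges G" "is_path G y xs v"
      by (auto simp: is_path_def)
    with Cons.IH [of y] Cons show ?thesis by auto
  qed
qed (simp add: is_path_def)

lemma is_path_drop:
  assumes "is_path G u (ys @ w # zs) v"
  shows "is_path G w (w # zs) v"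
  using assms by (auto simp: is_path_def successively_append_iff)

text \<open>The distance is defined by paths without repetition. If \<open>u\<close> already lies on
  the path from its successor \<open>w\<close>, the suffix beginning at \<open>u\<close> is a path
  that is no longer; otherwise \<open>u\<close> can be prepended.\<close>

lemma reach_imp_is_path:
  assumes "simple_graph G" "reach G k u v" "u \<in> verts G"
  shows "\<exists>xs. is_path G u xs v \<and> length xs - 1 \<le> k"
  using assms(2,3)
proof (induction k arbitrary: u)
  case 0
  then show ?case by (auto simp: is_path_def intro!: exI [of _ "[u]"])
next
  case (Suc k)
  show ?case
  proof (cases "u = v")
    case True
    with Suc.prems show ?thesis by (auto simp: is_path_def intro!: exI [of _ "[u]"])
  next
    case False
    with Suc.prems obtain w where w: "{u, w} \<in> edges G" "reach G k w v" by auto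
    with Suc.IH simple_graph_edge [OF assms(1) w(1)] obtain xs where
      xs: "is_path G w xs v" "length xs - 1 \<le> k" by blast
    show ?thesis
    proof (cases "u \<in> set xs")
      case True
      then obtain ys zs where eq: "xs = ys @ u # zs" by (auto simp: in_set_conv_decomp)
      with xs is_path_drop show ?thesis by (intro exI [of _ "u # zs"]) auto
    next
      case False
      have "is_path G u (u # xs) v"
        using xs(1) w(1) False Suc.prems(2) by (auto simp: is_path_def successively_Cons)
      with xs show ?thesis by (intro exI [of _ "u # xs"]) (auto simp: is_path_def)
    qed
  qed
qed

lemma graph_dist_le_iff:
  assumes "simple_graph G" "u \<in> verts G"
  shows "graph_dist G u v \<le> enat k \<longleftrightarrow> reach G k u v"
proof
  assume "reach G k u v"
  from reach_imp_is_path [OF assms(1) this assms(2)] obtain xs where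
    "is_path G u xs v" "length xs - 1 \<le> k" by blast
  then show "graph_dist G u v \<le> enat k"
    unfolding graph_dist_def by (intro INF_lower2 [of xs]) auto
next
  assume *: "graph_dist G u v \<le> enat k"
  \<comment> \<open>A strict bound on an infimum yields a path witnessing it, and a length below
    \<open>Suc k\<close> is at most \<open>k\<close>.\<close>
  then have "graph_dist G u v < enat (Suc k)"
    using le_less_trans by fastforce
  then obtain xs where "is_path G u xs v" "length xs - 1 \<le> k"
    unfolding graph_dist_def INF_less_iff by auto
  then show "reach G k u v"
    by (rule reach_mono [OF is_path_imp_reach])
qed

section \<open>Forests\<close>

text \<open>Acyclicity in disguise: a cycle would be a subgraph with all degrees 2. This form passes
  to induced subgraphs at once and directly supplies the leaf for an induction.\<close>

definition forest :: "'a ugraph \<Rightarrow> bool" where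
  "forest G \<longleftrightarrow> simple_graph G \<and>
     (\<forall>H. subgraph H G \<and> verts H \<noteq> {} \<longrightarrow> (\<exists>v\<in>verts H. vdegree H v \<le> 1))"

lemma simple_graph_finite_edges: "simple_graph G \<Longrightarrow> finite (edges G)"
  unfolding simple_graph_def by (rule finite_subset [of _ "Pow (verts G)"]) auto

lemma forest_if_degeneracy_le_1:
  assumes G: "simple_graph G" and d: "degeneracy G \<le> 1"
  shows "forest G"
proof -
  let ?P = "\<lambda>d. \<forall>H. subgraph H G \<and> verts H \<noteq> {} \<longrightarrow> (\<exists>v\<in>verts H. vdegree H v \<le> d)"
  \<comment> \<open>The \<open>LEAST\<close> has its defining property only once some bound exists;
    the number of edges bounds every degree.\<close>
  have "?P (card (edges G))"
  proof (intro allI impI)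
    fix H assume H: "subgraph H G \<and> verts H \<noteq> {}"
    then obtain v where "v \<in> verts H" by blast
    moreover have "vdegree H v \<le> card (edges G)"
      unfolding vdegree_def using H simple_graph_finite_edges [OF G]
      by (intro card_mono) (auto simp: subgraph_def)
    ultimately show "\<exists>v\<in>verts H. vdegree H v \<le> card (edges G)" by blast
  qed
  then have "?P (degeneracy G)"
    unfolding degeneracy_def by (rule LeastI)
  then show ?thesis
    unfolding forest_def using G d le_trans by metis
qed

lemma simple_graph_induced: "simple_graph G \<Longrightarrow> simple_graph (induced_subgraph G S)"
  by (auto simp: simple_graph_def induced_subgraph_def)

lemma forest_induced:
  assumes "forest G"
  shows "forest (induced_subgraph G S)"
proof -
  have "subgraph H G" if "subgraph H (induced_subgraph G S)" for H
    using that by (auto simp: subgraph_def induced_subgraph_def)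
  with assms simple_graph_induced show ?thesis unfolding forest_def by blast
qed

section \<open>Leaves, including isolated vertices, and their deletion\<close>

lemma forest_leaf:
  assumes "forest G" "verts G \<noteq> {}"
  obtains v where "v \<in> verts G" "\<And>u u'. {v, u} \<in> edges G \<Longrightarrow> {v, u'} \<in> edges G \<Longrightarrow> u = u'"
proof -
  have G: "simple_graph G" using assms(1) by (simp add: forest_def)
  then have "subgraph G G" by (simp add: subgraph_def)
  with assms obtain v where v: "v \<in> verts G" "vdegree G v \<le> 1" unfolding forest_def by blast
  have "u = u'" if "{v, u} \<in> edges G" "{v, u'} \<in> edges G" for u u'
  proof -
    have "finite {e \<in> edges G. v \<in> e}" using simple_graph_finite_edges [OF G] by simp
    with v(2) that have "{v, u} = {v, u'}"
      unfolding vdegree_def by (auto simp: card_le_Suc0_iff_eq)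
    then show ?thesis by (auto simp: doubleton_eq_iff)
  qed
  with v(1) that show thesis by blast
qed

text \<open>A walk enters and leaves a leaf through the same neighbour, so a visit in its interior
  can be cut out. A walk that starts at the leaf must first step to that neighbour \<open>u\<close>,
  so distances from \<open>v\<close> are one more than distances from \<open>u\<close> in the
  remaining graph.\<close>

lemma reach_delete_leaf:
  assumes G: "simple_graph G" and v: "v \<in> verts G"
    and leaf: "\<And>u u'. {v, u} \<in> edges G \<Longrightarrow> {v, u'} \<in> edges G \<Longrightarrow> u = u'"
    and "reach G k x y" "y \<noteq> v"
  shows "if x = v then \<exists>u l. k = Suc l \<and> {v, u} \<in> edges G \<and> u \<noteq> v \<and>
             reach (induced_subgraph G (verts G - {v})) l u y
         else reach (induced_subgraph G (verts G - {v})) k x y"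
  using assms(4)
proof (induction k arbitrary: x)
  case 0
  with assms(5) show ?case by auto
next
  case (Suc k)
  let ?H = "induced_subgraph G (verts G - {v})"
  show ?case
  proof (cases "x = y")
    case True
    with assms(5) show ?thesis by simp
  next
    case False
    with Suc.prems obtain w where w: "{x, w} \<in> edges G" "reach G k w y" by auto
    note wG = simple_graph_edge [OF G w(1)]
    show ?thesis
    proof (cases "w = v")
      case True
      with Suc.IH [OF w(2)] obtain u l where u: "k = Suc l" "{v, u} \<in> edges G" "reach ?H l u y"
        by auto
      with leaf [of x u] w True have "u = x" by (simp add: insert_commute)
      with u True wG show ?thesis using reach_mono [of ?H l x y "Suc k"] by auto
    next
      case False
      then have *: "reach ?H k w y" using Suc.IH [OF w(2)] by simp
      show ?thesis
      proof (cases "x = v")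
        case True
        with * w False show ?thesis by auto
      next
        case xv: False
        then have "{x, w} \<in> edges ?H" using w wG False by (auto simp: induced_subgraph_def)
        with * xv show ?thesis by auto
      qed
    qed
  qed
qed

text \<open>The four-point condition
  \<open>d(x, y) + d(a, b) \<le> max (d(x, a) + d(y, b)) (d(x, b) + d(y, a))\<close> of tree metrics, stated in
  terms of \<open>reach\<close>.\<close>

definition four_point :: "'a ugraph \<Rightarrow> 'a \<Rightarrow> 'a \<Rightarrow> 'a \<Rightarrow> 'a \<Rightarrow> bool" where
  "four_point G x y a b \<longleftrightarrow> (\<forall>i j i' j' m.
     reach G i x a \<longrightarrow> reach G j y b \<longrightarrow> reach G i' x b \<longrightarrow> reach G j' y a \<longrightarrow>
     i + j \<le> m \<longrightarrow> i' + j' \<le> m \<longrightarrow> (\<exists>p q. reach G p x y \<and> reach G q a b \<and> p + q \<le> m))"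

section \<open>Symmetries and degenerate cases of the four-point condition\<close>

lemma four_pointI:
  assumes "\<And>i j i' j' m. reach G i x a \<Longrightarrow> reach G j y b \<Longrightarrow> reach G i' x b \<Longrightarrow> reach G j' y a \<Longrightarrow>
     i + j \<le> m \<Longrightarrow> i' + j' \<le> m \<Longrightarrow> \<exists>p q. reach G p x y \<and> reach G q a b \<and> p + q \<le> m"
  shows "four_point G x y a b"
  using assms unfolding four_point_def by simp

lemma four_pointE:
  assumes "four_point G x y a b"
    "reach G i x a" "reach G j y b" "reach G i' x b" "reach G j' y a" "i + j \<le> m" "i' + j' \<le> m"
  obtains p q where "reach G p x y" "reach G q a b" "p + q \<le> m"
  using assms unfolding four_point_def by meson

lemma four_point_swap:
  assumes "four_point G x y a b"
  shows "four_point G y x a b"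
proof (rule four_pointI)
  fix i j i' j' m
  assume *: "reach G i y a" "reach G j x b" "reach G i' y b" "reach G j' x a"
    "i + j \<le> m" "i' + j' \<le> m"
  show "\<exists>p q. reach G p y x \<and> reach G q a b \<and> p + q \<le> m"
    by (rule four_pointE [OF assms *(4,3,2,1)]) (use * in \<open>auto simp: add.commute dest: reach_sym\<close>)
qed

lemma four_point_flip:
  assumes "four_point G x y a b"
  shows "four_point G a b x y"
proof (rule four_pointI)
  fix i j i' j' m
  assume *: "reach G i a x" "reach G j b y" "reach G i' a y" "reach G j' b x"
    "i + j \<le> m" "i' + j' \<le> m"
  show "\<exists>p q. reach G p a b \<and> reach G q x y \<and> p + q \<le> m"
  proof (rule four_pointE [OF assms reach_sym [OF *(1)] reach_sym [OF *(2)] reach_sym [OF *(4)]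
          reach_sym [OF *(3)], of m])
    fix p q assume "reach G p x y" "reach G q a b" "p + q \<le> m"
    then show ?thesis by (intro exI [of _ q] exI [of _ p]) simp
  qed (use * in simp_all)
qed

text \<open>This degenerate case is the triangle inequality through \<open>x\<close>.\<close>

lemma four_point_eq1: "four_point G x x a b"
proof (rule four_pointI)
  fix i j i' j' m
  assume *: "reach G i x a" "reach G j x b" "i + j \<le> m"
  then have "reach G (i + j) a b" using reach_trans reach_sym by metis
  with *(3) show "\<exists>p q. reach G p x x \<and> reach G q a b \<and> p + q \<le> m"
    by (intro exI [of _ 0] exI [of _ "i + j"]) simp
qed

text \<open>For \<open>a = x\<close> the left-hand sum is itself the second sum on the
  right.\<close>

lemma four_point_eq2: "four_point G x y x b"
proof (rule four_pointI)
  fix i j i' j' m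
  assume *: "reach G i' x b" "reach G j' y x" "i' + j' \<le> m"
  from reach_sym [OF *(2)] *(1,3)
  show "\<exists>p q. reach G p x y \<and> reach G q x b \<and> p + q \<le> m"
    by (intro exI [of _ j'] exI [of _ i']) simp
qed

text \<open>Induction by deleting a leaf \<open>v\<close>. If \<open>v\<close> is exactly one of the
  four points, it occurs once in each of the three sums; replacing it by its neighbour lowers each
  of them by one, so the condition carries over from the smaller forest.\<close>

lemma four_point_forest:
  assumes "forest G"
  shows "four_point G x y a b"
  using assms
proof (induction "card (verts G)" arbitrary: G x y a b rule: less_induct)
  case (less G x y a b)
  have G: "simple_graph G" using less.prems by (simp add: forest_def)
  show ?case
  proof (cases "verts G = {}")
    case True
    with G have "edges G = {}" by (auto simp: simple_graph_def)
    then have "reach G k u w \<longleftrightarrow> u = w" for k u w by (cases k) auto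
    then show ?thesis by (intro four_pointI) (auto intro!: exI [of _ 0])
  next
    case False
    from forest_leaf [OF less.prems this] obtain v where v: "v \<in> verts G"
      and leaf: "\<And>u u'. {v, u} \<in> edges G \<Longrightarrow> {v, u'} \<in> edges G \<Longrightarrow> u = u'" by metis
    let ?H = "induced_subgraph G (verts G - {v})"
    have "card (verts ?H) < card (verts G)"
      using G v by (intro psubset_card_mono) (auto simp: simple_graph_def induced_subgraph_def)
    then have IH: "four_point ?H x y a b" for x y a b
      using less.hyps forest_induced [OF less.prems] by blast
    have sub: "reach G k u w" if "reach ?H k u w" for k u w
      using reach_subgraph [OF that] by (auto simp: induced_subgraph_def)
    have del: "if x = v then \<exists>u l. k = Suc l \<and> {v, u} \<in> edges G \<and> u \<noteq> v \<and> reach ?H l u y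
        else reach ?H k x y" if "reach G k x y" "y \<noteq> v" for k x y
      using reach_delete_leaf [OF G v _ that] leaf by blast
    have leaf_case: "four_point G v y a b" if "y \<noteq> v" "a \<noteq> v" "b \<noteq> v" for y a b
    proof (rule four_pointI)
      fix i j i' j' m
      assume *: "reach G i v a" "reach G j y b" "reach G i' v b" "reach G j' y a"
        "i + j \<le> m" "i' + j' \<le> m"
      from del [OF *(1)] that obtain u l where u: "i = Suc l" "{v, u} \<in> edges G" "reach ?H l u a"
        by auto
      from del [OF *(3)] that obtain u' l' where u': "i' = Suc l'" "{v, u'} \<in> edges G"
        "reach ?H l' u' b" by auto
      have [simp]: "u' = u" using leaf u u' by blast
      have "reach ?H j y b" "reach ?H j' y a" using del [OF *(2)] del [OF *(4)] that by auto
      moreover have "l + j \<le> m - 1" "l' + j' \<le> m - 1" using u(1) u'(1) *(5,6) by auto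
      moreover have "reach ?H l' u b" using u'(3) by simp
      ultimately obtain p q where pq: "reach ?H p u y" "reach ?H q a b" "p + q \<le> m - 1"
        using four_pointE [OF IH u(3)] by metis
      have "reach G (Suc p) v y" using u(2) sub [OF pq(1)] by auto
      with sub [OF pq(2)] pq(3) u(1) *(5)
      show "\<exists>p q. reach G p v y \<and> reach G q a b \<and> p + q \<le> m"
        by (intro exI [of _ "Suc p"] exI [of _ q]) auto
    qed
    \<comment> \<open>If \<open>v\<close> is more than one of the four points, two of them coincide,
      which the first six cases cover.\<close>
    consider "x = y" | "a = b" | "x = a" | "x = b" | "y = a" | "y = b"
      | "x = v" "y \<noteq> v" "a \<noteq> v" "b \<noteq> v" | "y = v" "x \<noteq> v" "a \<noteq> v" "b \<noteq> v"
      | "a = v" "x \<noteq> v" "y \<noteq> v" "b \<noteq> v" | "b = v" "x \<noteq> v" "y \<noteq> v" "a \<noteq> v"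
      | "x \<noteq> v" "y \<noteq> v" "a \<noteq> v" "b \<noteq> v" by argo
    then show ?thesis
    proof cases
      case 1
      then show ?thesis using four_point_eq1 by metis
    next
      case 2
      then show ?thesis using four_point_flip [OF four_point_eq1] by metis
    next
      case 3
      then show ?thesis using four_point_eq2 by metis
    next
      case 4
      then show ?thesis using four_point_flip [OF four_point_swap [OF four_point_eq2]] by metis
    next
      case 5
      then show ?thesis using four_point_swap [OF four_point_eq2] by metis
    next
      case 6
      then show ?thesis using four_point_swap [OF four_point_flip [OF four_point_swap [OF four_point_eq2]]] by metis
    next
      case 7
      then show ?thesis by (simp add: leaf_case)
    next
      case 8
      then show ?thesis by (simp add: four_point_swap [OF leaf_case])
    next
      case 9
      then show ?thesis by (simp add: four_point_flip [OF leaf_case])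
    next
      case 10
      then show ?thesis by (simp add: four_point_flip [OF four_point_swap [OF leaf_case]])
    next
      case 11
      show ?thesis
      proof (rule four_pointI)
        fix i j i' j' m
        assume *: "reach G i x a" "reach G j y b" "reach G i' x b" "reach G j' y a"
          "i + j \<le> m" "i' + j' \<le> m"
        then have "reach ?H i x a" "reach ?H j y b" "reach ?H i' x b" "reach ?H j' y a"
          using del [OF *(1)] del [OF *(2)] del [OF *(3)] del [OF *(4)] 11 by auto
        from four_pointE [OF IH this *(5,6)] obtain p q where
          "reach ?H p x y" "reach ?H q a b" "p + q \<le> m" .
        then show "\<exists>p q. reach G p x y \<and> reach G q a b \<and> p + q \<le> m"
          using sub by blast
      qed
    qed
  qed
qed

section \<open>Maximum cliques and clubs in forests\<close>

definition lens :: "'a ugraph \<Rightarrow> nat \<Rightarrow> 'a \<Rightarrow> 'a \<Rightarrow> 'a set" where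
  "lens G D a b = {w \<in> verts G. reach G D w a \<and> reach G D w b}"

text \<open>Both sums on the right of the four-point condition are at most \<open>D + D\<close>,
  while d(a, b) >= \<open>D\<close>. The case \<open>D = 0\<close> is listed separately because
  \<open>D - 1\<close> is then 0 again.\<close>

lemma lens_reach:
  assumes "forest G" "D = 0 \<or> \<not> reach G (D - 1) a b" "x \<in> lens G D a b" "y \<in> lens G D a b"
  shows "reach G D x y"
proof -
  from four_point_forest [OF assms(1), of x y a b] assms(3,4) obtain p q where
    pq: "reach G p x y" "reach G q a b" "p + q \<le> D + D"
    unfolding four_point_def lens_def by blast
  have "D \<le> q"
  proof (rule ccontr)
    assume "\<not> D \<le> q"
    then have "q \<le> D - 1" "D \<noteq> 0" by auto
    with assms(2) reach_mono [OF pq(2)] show False by blast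
  qed
  with pq show ?thesis by (intro reach_mono [OF pq(1)]) simp
qed

text \<open>\<open>w\<close> is the second vertex of a shortest path from \<open>x\<close> to
  \<open>y\<close>, of length \<open>p + 1\<close>. The four-point condition bounds d(w, a) + d(x,
  y) by the maximum of \<open>1 + D\<close> and \<open>p + D\<close>, and d(x, y) > \<open>p\<close>
  leaves at most \<open>D\<close> for d(w, a). Applied to \<open>a\<close> and to \<open>b\<close>,
  this keeps \<open>w\<close> in the lens.\<close>

lemma lens_convex_step:
  assumes "forest G" "\<not> reach G p x y" "{x, w} \<in> edges G" "reach G p w y"
    "reach G D x a" "reach G D y a"
  shows "reach G D w a"
proof -
  have "reach G 1 w x" using assms(3) by (auto simp: insert_commute)
  with four_point_forest [OF assms(1), of w a x y] assms(4-6) obtain r q where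
    rq: "reach G r w a" "reach G q x y" "r + q \<le> max (1 + D) (p + D)"
    using four_pointE [of G w a x y 1 D p D "max (1 + D) (p + D)"]
    by (metis max.cobounded1 max.cobounded2 reach_sym)
  have "p < q" using assms(2) reach_mono [OF rq(2)] not_less by blast
  with rq(3) have "r \<le> D" by auto
  with rq(1) show ?thesis by (rule reach_mono)
qed

text \<open>When \<open>p\<close> cannot be lowered, the walk is shortest and its first step stays
  in the lens by \<open>lens_convex_step\<close>; otherwise the bound for the smaller
  \<open>p\<close> applies.\<close>

lemma lens_reach_induced:
  assumes "forest G" "x \<in> lens G D a b" "y \<in> lens G D a b" "reach G p x y"
  shows "reach (induced_subgraph G (lens G D a b)) p x y"
  using assms(2,4)
proof (induction p arbitrary: x)
  case (Suc p)
  let ?H = "induced_subgraph G (lens G D a b)"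
  show ?case
  proof (cases "reach G p x y")
    case True
    with Suc reach_mono [of ?H p x y "Suc p"] show ?thesis by simp
  next
    case False
    then have "x \<noteq> y" by auto
    with Suc.prems obtain w where w: "{x, w} \<in> edges G" "reach G p w y" by auto
    have "simple_graph G" using assms(1) by (simp add: forest_def)
    with w have "w \<in> verts G" using simple_graph_edge by metis
    then have wT: "w \<in> lens G D a b"
      using lens_convex_step [OF assms(1) False w] Suc.prems(1) assms(3) by (auto simp: lens_def)
    with w(1) Suc.prems(1) have "{x, w} \<in> edges ?H" by (simp add: induced_subgraph_def)
    with Suc.IH [OF wT w(2)] show ?thesis by auto
  qed
qed simp

section \<open>Reduction of both problems to lenses\<close>

lemma is_clique_iff:
  assumes "simple_graph G"
  shows "is_clique s G S \<longleftrightarrow> S \<subseteq> verts G \<and> (\<forall>u\<in>S. \<forall>v\<in>S. reach G s u v)"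
  unfolding is_clique_def using graph_dist_le_iff [OF assms] by blast

lemma is_club_iff:
  assumes "simple_graph G"
  shows "is_club s G S \<longleftrightarrow>
    S \<subseteq> verts G \<and> (\<forall>u\<in>S. \<forall>v\<in>S. reach (induced_subgraph G S) s u v)"
proof -
  have "graph_dist (induced_subgraph G S) u v \<le> enat s \<longleftrightarrow> reach (induced_subgraph G S) s u v"
    if "S \<subseteq> verts G" "u \<in> S" for u v
    using that by (intro graph_dist_le_iff simple_graph_induced [OF assms])
      (auto simp: induced_subgraph_def)
  then show ?thesis unfolding is_club_def by (meson subsetD)
qed

lemma is_club_imp_is_clique:
  assumes "simple_graph G" "is_club s G S"
  shows "is_clique s G S"
proof -
  have "edges (induced_subgraph G S) \<subseteq> edges G" by (auto simp: induced_subgraph_def)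
  with assms show ?thesis
    unfolding is_clique_iff [OF assms(1)] is_club_iff [OF assms(1)]
    by (meson reach_subgraph)
qed

lemma is_club_lens:
  assumes "forest G" "D = 0 \<or> \<not> reach G (D - 1) a b" "D \<le> s"
  shows "is_club s G (lens G D a b)"
proof -
  have G: "simple_graph G" using assms(1) by (simp add: forest_def)
  show ?thesis
    unfolding is_club_iff [OF G]
  proof (intro conjI ballI)
    fix u v assume uv: "u \<in> lens G D a b" "v \<in> lens G D a b"
    show "reach (induced_subgraph G (lens G D a b)) s u v"
      by (rule reach_mono [OF lens_reach_induced [OF assms(1) uv lens_reach [OF assms(1,2) uv]] assms(3)])
  qed (auto simp: lens_def)
qed

lemma clique_subset_lens:
  assumes "simple_graph G" "is_clique s G S" "S \<noteq> {}"
  obtains D a b where "D \<le> s" "a \<in> S" "b \<in> S" "reach G D a b" "D = 0 \<or> \<not> reach G (D - 1) a b"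
    "S \<subseteq> lens G D a b"
proof -
  let ?P = "\<lambda>D. \<forall>u\<in>S. \<forall>v\<in>S. reach G D u v"
  \<comment> \<open>The diameter of \<open>S\<close>, as the least uniform bound; \<open>s\<close>
    shows that one exists, and minimality provides the diametral pair.\<close>
  define D where "D = Least ?P"
  have s: "?P s" "S \<subseteq> verts G" using assms(2) by (auto simp: is_clique_iff [OF assms(1)])
  have D: "?P D" "D \<le> s"
    unfolding D_def by (rule LeastI [of ?P, OF s(1)], rule Least_le [of ?P, OF s(1)])
  have "\<exists>a\<in>S. \<exists>b\<in>S. D = 0 \<or> \<not> reach G (D - 1) a b"
  proof (cases "D = 0")
    case True
    with assms(3) show ?thesis by blast
  next
    case False
    then have "\<not> ?P (D - 1)" unfolding D_def by (intro not_less_Least) simp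
    then show ?thesis by blast
  qed
  then obtain a b where "a \<in> S" "b \<in> S" "D = 0 \<or> \<not> reach G (D - 1) a b" by blast
  with D s that [of D a b] show thesis unfolding lens_def by blast
qed

text \<open>The two conditions on \<open>reach\<close> say d(a, b) = \<open>D\<close>. For
  \<open>k <= 0\<close> the empty set is a solution, also in the graph without vertices, where no
  lens exists.\<close>

definition has_large_lens :: "nat \<Rightarrow> instance_type \<Rightarrow> bool" where
  "has_large_lens s = (\<lambda>(G, k). k \<le> 0 \<or> (\<exists>a\<in>verts G. \<exists>b\<in>verts G. \<exists>D\<le>s.
     reach G D a b \<and> (D = 0 \<or> \<not> reach G (D - 1) a b) \<and> k \<le> int (card (lens G D a b))))"

lemma problems_iff_has_large_lens:
  assumes "forest G"
  shows "s_club_problem s (G, k) \<longleftrightarrow> has_large_lens s (G, k)"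
    and "s_clique_problem s (G, k) \<longleftrightarrow> has_large_lens s (G, k)"
proof -
  have G: "simple_graph G" using assms(1) by (simp add: forest_def)
  have 1: "s_clique_problem s (G, k)" if "s_club_problem s (G, k)"
    using that is_club_imp_is_clique [OF G] by (auto simp: s_club_problem_def s_clique_problem_def)
  have 2: "has_large_lens s (G, k)" if "s_clique_problem s (G, k)"
  proof (cases "k \<le> 0")
    case False
    from that obtain S where S: "is_clique s G S" "k \<le> int (card S)"
      by (auto simp: s_clique_problem_def)
    with False have "S \<noteq> {}" by auto
    from clique_subset_lens [OF G S(1) this] obtain D a b where
      *: "D \<le> s" "a \<in> S" "b \<in> S" "reach G D a b" "D = 0 \<or> \<not> reach G (D - 1) a b"
      "S \<subseteq> lens G D a b" by blast
    have "finite (lens G D a b)" using G by (simp add: simple_graph_def lens_def)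
    from card_mono [OF this *(6)] S(2) have "k \<le> int (card (lens G D a b))" by linarith
    moreover have "S \<subseteq> verts G" using S(1) by (simp add: is_clique_def)
    ultimately have "a \<in> verts G" "b \<in> verts G" "k \<le> int (card (lens G D a b))" using * by auto
    with *(1,4,5) show ?thesis unfolding has_large_lens_def prod.case by (intro disjI2) metis
  qed (simp add: has_large_lens_def)
  have 3: "s_club_problem s (G, k)" if "has_large_lens s (G, k)"
  proof (cases "k \<le> 0")
    case True
    then show ?thesis
      unfolding s_club_problem_def by (auto simp: is_club_def intro!: exI [of _ "{}"])
  next
    case False
    with that is_club_lens [OF assms] show ?thesis
      unfolding has_large_lens_def s_club_problem_def by blast
  qed
  show "s_club_problem s (G, k) \<longleftrightarrow> has_large_lens s (G, k)"
    and "s_clique_problem s (G, k) \<longleftrightarrow> has_large_lens s (G, k)"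
    using 1 2 3 by blast+
qed

section \<open>Reading the input\<close>

lemma length_concat_uniform:
  "(\<And>i. i < m \<Longrightarrow> length (f i) = n) \<Longrightarrow> length (concat (map f [0..<m])) = m * n"
  by (induction m) auto

lemma nth_concat_uniform:
  assumes "\<And>i. i < m \<Longrightarrow> length (f i) = n" "u < m" "v < n"
  shows "concat (map f [0..<m]) ! (u * n + v) = f u ! v"
  using assms(1,2)
proof (induction m)
  case (Suc m)
  then have len: "length (concat (map f [0..<m])) = m * n" by (intro length_concat_uniform) simp
  show ?case
  proof (cases "u = m")
    case True
    then show ?thesis using len by (simp add: nth_append)
  next
    case False
    with Suc.prems have um: "u < m" by simp
    have "u * n + v < Suc u * n" using assms(3) by simp
    also have "\<dots> \<le> m * n" using um by (intro mult_le_mono1) simp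
    finally have "u * n + v < length (concat (map f [0..<m]))" using len by simp
    with Suc um show ?thesis by (simp add: nth_append)
  qed
qed simp

text \<open>Horner's rule, with doubling written as an addition because the machine cannot
  multiply.\<close>

lemma foldr_nat_bits: "foldr (\<lambda>b a. of_bool b + (a + a)) (nat_bits m) 0 = m"
proof (induction m rule: nat_bits.induct)
  case (1 m)
  then show ?case by (subst nat_bits.simps) (simp, presburger)
qed

text \<open>The loop reads the word backwards. After \<open>length xs\<close> rounds it has consumed
  \<open>xs\<close>, and the guard makes the remaining \<open>length pre\<close> rounds idle, since
  loops always run for the whole input length.\<close>

lemma rec_nat_foldr:
  "rec_nat 0 (\<lambda>i a. if length pre + i < length (pre @ xs)
      then g ((pre @ xs) ! (length (pre @ xs) - Suc i)) a else a) (length (pre @ xs)) = foldr g xs 0"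
  (is "rec_nat 0 ?h _ = _")
proof -
  have "rec_nat 0 ?h i = foldr g (drop (length xs - i) xs) 0" if "i \<le> length xs" for i
    using that
  proof (induction i)
    case (Suc i)
    then have "length xs - i = Suc (length xs - Suc i)" "length xs - Suc i < length xs" by auto
    moreover have "(pre @ xs) ! (length (pre @ xs) - Suc i) = xs ! (length xs - Suc i)"
      using Suc.prems nth_append_length_plus [of pre xs "length xs - Suc i"] by simp
    ultimately show ?case
      using Suc Cons_nth_drop_Suc [of "length xs - Suc i" xs, symmetric] by simp
  qed simp
  from this [of "length xs"] have 1: "rec_nat 0 ?h (length xs) = foldr g xs 0" by simp
  have "rec_nat 0 ?h (length xs + j) = foldr g xs 0" for j
    by (induction j) (use 1 in auto)
  from this [of "length pre"] show ?thesis by (simp add: add.commute)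
qed

lemma encode_instance_layout:
  fixes G :: "nat ugraph" and k :: int
  defines "n \<equiv> card (verts G)" and "w \<equiv> encode_instance (G, k)"
  shows "n < length w" and "\<And>i. i < n \<Longrightarrow> w ! i" and "\<not> w ! n"
    and "n + (n * n + 1) < length w" and "w ! (n + (n * n + 1)) \<longleftrightarrow> k < 0"
    and "\<And>u v. u < n \<Longrightarrow> v < n \<Longrightarrow> n + (u * n + v + 1) < length w"
    and "\<And>u v. u < n \<Longrightarrow> v < n \<Longrightarrow> w ! (n + (u * n + v + 1)) \<longleftrightarrow> {u, v} \<in> edges G"
    and "rec_nat 0 (\<lambda>i a. if n + (n * n + 2) + i < length w
           then of_bool (w ! (length w - Suc i)) + (a + a) else a) (length w) = nat \<bar>k\<bar>"
proof -
  let ?f = "\<lambda>i. map (\<lambda>j. {i, j} \<in> edges G) [0..<n]"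
  define M where "M = concat (map ?f [0..<n])"
  have w: "w = replicate n True @ [False] @ M @ [k < 0] @ nat_bits (nat \<bar>k\<bar>)"
    unfolding w_def encode_instance_def M_def n_def by (simp add: Let_def)
  have M: "length M = n * n"
    unfolding M_def by (rule length_concat_uniform) simp
  show "n < length w" "\<not> w ! n" "n + (n * n + 1) < length w" "w ! (n + (n * n + 1)) \<longleftrightarrow> k < 0"
    using M by (simp_all add: w nth_append)
  show "w ! i" if "i < n" for i using that by (simp add: w nth_append)
  fix u v assume uv: "u < n" "v < n"
  have "u * n + v < Suc u * n" using uv by simp
  also have "\<dots> \<le> n * n" using uv by (intro mult_le_mono1) simp
  finally have less: "u * n + v < n * n" .
  then show "n + (u * n + v + 1) < length w" using M by (simp add: w)
  have "M ! (u * n + v) \<longleftrightarrow> {u, v} \<in> edges G"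
    unfolding M_def using nth_concat_uniform [of n ?f n u v] uv by simp
  then show "w ! (n + (u * n + v + 1)) \<longleftrightarrow> {u, v} \<in> edges G"
    using M less by (simp add: w nth_append)
next
  let ?f = "\<lambda>i. map (\<lambda>j. {i, j} \<in> edges G) [0..<n]"
  define M where "M = concat (map ?f [0..<n])"
  let ?pre = "replicate n True @ [False] @ M @ [k < 0]"
  have w: "w = ?pre @ nat_bits (nat \<bar>k\<bar>)"
    unfolding w_def encode_instance_def M_def n_def by (simp add: Let_def)
  have "length M = n * n"
    unfolding M_def by (rule length_concat_uniform) simp
  then have len: "length ?pre = n + (n * n + 2)" by simp
  from rec_nat_foldr [of ?pre "nat_bits (nat \<bar>k\<bar>)" "\<lambda>b a. of_bool b + (a + a :: nat)"] show
    "rec_nat 0 (\<lambda>i a. if n + (n * n + 2) + i < length w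
       then of_bool (w ! (length w - Suc i)) + (a + a) else a) (length w) = nat \<bar>k\<bar>"
    by (simp only: w [symmetric] len foldr_nat_bits)
qed

section \<open>The algorithm\<close>

context
  fixes I :: "instance_type set"
  assumes I: "I \<subseteq> instances"
begin

abbreviation "pfun \<equiv> polyf encode_instance I"
abbreviation "ppred \<equiv> polyp encode_instance I"

text \<open>The accumulator is itself the reading position: it advances over the leading ones and
  gets stuck at the separator.\<close>

lemma polyf_card_verts: "pfun (\<lambda>x \<rho>. card (verts (fst x)))"
proof (rule polyf_cong, rule polyf_rec)
  show "pfun (\<lambda>x \<rho>. if of_bool (\<rho> 1 < length (encode_instance x) \<and> encode_instance x ! \<rho> 1) = (1 :: nat)
      then \<rho> 1 + 1 else \<rho> 1)"
    by (intro polyf_If polyp_eq polyf_input polyf_const polyf_add polyf_var)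
  fix x :: instance_type
  obtain G k where x: "x = (G, k)" by fastforce
  let ?n = "card (verts G)" and ?w = "encode_instance (G, k)"
  note lay = encode_instance_layout [where G = G and k = k]
  have "rec_nat 0 (\<lambda>i a. if of_bool (a < length ?w \<and> ?w ! a) = (1 :: nat) then a + 1 else a) m
      = min m ?n" for m
  proof (induction m)
    case (Suc m)
    have "min m ?n < length ?w" using lay(1) by simp
    moreover have "?w ! min m ?n \<longleftrightarrow> m < ?n" using lay(2) [of m] lay(3) 
      by (cases "m < ?n") (simp_all add: min.absorb1 min.absorb2)
    ultimately show ?case using Suc by simp
  qed simp
  then show "rec_nat 0 (\<lambda>i a. if of_bool (a < length (encode_instance x) \<and> encode_instance x ! a) = (1 :: nat)
      then a + 1 else a) (length (encode_instance x)) = card (verts (fst x))"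
    using lay(1) by (simp add: x)
qed

text \<open>Multiplication as repeated addition: among all positions of the input, exactly those
  below the number of vertices contribute a summand.\<close>

lemma polyf_times_card_verts:
  assumes "pfun u"
  shows "pfun (\<lambda>x \<rho>. u x \<rho> * card (verts (fst x)))"
proof (rule polyf_cong, rule polyf_sum)
  show "pfun (\<lambda>x \<rho>. if \<rho> 0 < card (verts (fst x)) then u x (\<lambda>k. \<rho> (Suc k)) else 0)"
    by (intro polyf_If polyp_less polyf_var polyf_card_verts polyf_const assms [THEN polyf_rename [where h = Suc]])
  fix x :: instance_type and \<rho> :: "nat \<Rightarrow> nat"
  have "{..<length (encode_instance x)} \<inter> {i. i < card (verts (fst x))} = {..<card (verts (fst x))}"
    using encode_instance_layout(1) [of "fst x" "snd x"] by auto
  then show "(\<Sum>i<length (encode_instance x). if i < card (verts (fst x)) then u x \<rho> else 0) =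
      u x \<rho> * card (verts (fst x))"
    by (simp add: sum.If_cases)
qed

lemma polyp_input:
  assumes "pfun f"
  shows "ppred (\<lambda>x \<rho>. f x \<rho> < length (encode_instance x) \<and> encode_instance x ! f x \<rho>)"
  unfolding polyp_def by (rule polyf_input [OF assms])

lemma instances_edge:
  assumes "x \<in> I" "{u, v} \<in> edges (fst x)"
  shows "u < card (verts (fst x))" "v < card (verts (fst x))"
proof -
  obtain G k where x: "x = (G, k)" by fastforce
  then have "simple_graph G" "verts G = {..<card (verts G)}"
    using assms(1) I by (auto simp: instances_def)
  with simple_graph_edge [OF this(1), of u v] assms(2) x
  show "u < card (verts (fst x))" "v < card (verts (fst x))" by auto
qed

text \<open>The range tests matter: with an index outside the range, the computed position could
  fall into another row or onto the sign bit.\<close>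

lemma polyp_edge:
  assumes "pfun u" "pfun v"
  shows "ppred (\<lambda>x \<rho>. {u x \<rho>, v x \<rho>} \<in> edges (fst x))"
proof (rule polyp_cong)
  let ?n = "\<lambda>x :: instance_type. card (verts (fst x))"
  let ?a = "\<lambda>x \<rho>. ?n x + (u x \<rho> * ?n x + v x \<rho> + 1)"
  show "ppred (\<lambda>x \<rho>. u x \<rho> < ?n x \<and> v x \<rho> < ?n x \<and>
      ?a x \<rho> < length (encode_instance x) \<and> encode_instance x ! ?a x \<rho>)"
    by (intro polyp_conj polyp_less polyp_input polyf_add polyf_times_card_verts polyf_card_verts
        polyf_const polyf_length assms)
  fix x and \<rho> :: "nat \<Rightarrow> nat" assume x: "x \<in> I"
  show "(u x \<rho> < ?n x \<and> v x \<rho> < ?n x \<and>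
      ?a x \<rho> < length (encode_instance x) \<and> encode_instance x ! ?a x \<rho>) \<longleftrightarrow>
      {u x \<rho>, v x \<rho>} \<in> edges (fst x)"
    using instances_edge [OF x] encode_instance_layout(6,7) [of _ "fst x" _ "snd x"]
    unfolding prod.collapse by blast
qed

text \<open>The induction on \<open>k\<close> builds a different program for each \<open>k\<close>.
  Since \<open>u\<close> and \<open>v\<close> are arbitrary computable functions, the induction
  hypothesis applies with the loop variable \<open>w\<close> as the new start.\<close>

lemma polyp_reach:
  assumes "pfun u" "pfun v"
  shows "ppred (\<lambda>x \<rho>. reach (fst x) k (u x \<rho>) (v x \<rho>))"
  using assms
proof (induction k arbitrary: u v)
  case 0
  then show ?case by (simp add: polyp_eq)
next
  case (Suc k)
  show ?case
  proof (rule polyp_cong)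
    show "ppred (\<lambda>x \<rho>. u x \<rho> = v x \<rho> \<or> (\<exists>w<length (encode_instance x).
        {u x \<rho>, w} \<in> edges (fst x) \<and> reach (fst x) k w (v x \<rho>)))"
      by (intro polyp_disj polyp_eq polyp_ex polyp_conj polyp_edge Suc polyf_var
          Suc.prems [THEN polyf_rename [where h = Suc]])
    fix x and \<rho> :: "nat \<Rightarrow> nat" assume x: "x \<in> I"
    have "w < length (encode_instance x)" if "{u x \<rho>, w} \<in> edges (fst x)" for w
      using instances_edge(2) [OF x that] encode_instance_layout(1) [of "fst x" "snd x"] by simp
    then show "(u x \<rho> = v x \<rho> \<or> (\<exists>w<length (encode_instance x).
        {u x \<rho>, w} \<in> edges (fst x) \<and> reach (fst x) k w (v x \<rho>))) \<longleftrightarrow>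
        reach (fst x) (Suc k) (u x \<rho>) (v x \<rho>)"
      by auto
  qed
qed

lemma instances_verts_iff:
  assumes "x \<in> I"
  shows "a \<in> verts (fst x) \<longleftrightarrow> a < card (verts (fst x))"
proof -
  have "verts (fst x) = {..<card (verts (fst x))}"
    using assms I by (cases x) (auto simp: instances_def)
  then show ?thesis by blast
qed

lemma polyf_card_lens:
  assumes "pfun a" "pfun b"
  shows "pfun (\<lambda>x \<rho>. card (lens (fst x) D (a x \<rho>) (b x \<rho>)))"
proof (rule polyf_cong, rule polyf_card)
  show "ppred (\<lambda>x \<rho>. \<rho> 0 < card (verts (fst x)) \<and> reach (fst x) D (\<rho> 0) (a x (\<lambda>k. \<rho> (Suc k))) \<and>
      reach (fst x) D (\<rho> 0) (b x (\<lambda>k. \<rho> (Suc k))))"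
    by (intro polyp_conj polyp_less polyp_reach polyf_card_verts polyf_var
        assms [THEN polyf_rename [where h = Suc]])
  fix x and \<rho> :: "nat \<Rightarrow> nat" assume x: "x \<in> I"
  have "(i < length (encode_instance x) \<and> i < card (verts (fst x)) \<and> P) \<longleftrightarrow> i \<in> verts (fst x) \<and> P"
    for i P
    using encode_instance_layout(1) [of "fst x" "snd x"] instances_verts_iff [OF x, of i] by auto
  then show "card {i. i < length (encode_instance x) \<and> i < card (verts (fst x)) \<and>
      reach (fst x) D i (a x \<rho>) \<and> reach (fst x) D i (b x \<rho>)} =
      card (lens (fst x) D (a x \<rho>) (b x \<rho>))"
    unfolding lens_def by simp
qed

lemma polyp_negative: "ppred (\<lambda>x \<rho>. snd x < 0)"
proof (rule polyp_cong, rule polyp_input)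
  let ?n = "\<lambda>x :: instance_type. card (verts (fst x))"
  show "pfun (\<lambda>x \<rho>. ?n x + (?n x * ?n x + 1))"
    by (intro polyf_add polyf_times_card_verts polyf_card_verts polyf_const)
  fix x :: instance_type
  show "(?n x + (?n x * ?n x + 1) < length (encode_instance x) \<and>
      encode_instance x ! (?n x + (?n x * ?n x + 1))) \<longleftrightarrow> snd x < 0"
    using encode_instance_layout(4,5) [of "fst x" "snd x"] by simp
qed

lemma polyf_abs: "pfun (\<lambda>x \<rho>. nat \<bar>snd x\<bar>)"
proof (rule polyf_cong, rule polyf_rec)
  let ?n = "\<lambda>x :: instance_type. card (verts (fst x))" and ?w = "encode_instance"
  let ?j = "\<lambda>x i. length (?w x) - (i + 1)"
  show "pfun (\<lambda>x \<rho>. if ?n x + (?n x * ?n x + 2) + \<rho> 0 < length (?w x)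
      then of_bool (?j x (\<rho> 0) < length (?w x) \<and> ?w x ! ?j x (\<rho> 0)) + (\<rho> 1 + \<rho> 1) else \<rho> 1)"
    by (intro polyf_If polyp_less polyf_add polyf_times_card_verts polyf_card_verts polyf_const
        polyf_length polyf_var polyf_input polyf_diff)
  fix x :: instance_type
  \<comment> \<open>The range test that comes with \<open>polyf_input\<close> is implied by the
    outer guard, which forces the word to be nonempty.\<close>
  have "(if ?n x + (?n x * ?n x + 2) + i < length (?w x)
      then of_bool (?j x i < length (?w x) \<and> ?w x ! ?j x i) + (a + a) else a) =
    (if ?n x + (?n x * ?n x + 2) + i < length (?w x)
      then of_bool (?w x ! (length (?w x) - Suc i)) + (a + a) else a)" for i a :: nat
    by auto
  then show "rec_nat 0 (\<lambda>i a. if ?n x + (?n x * ?n x + 2) + i < length (?w x)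
      then of_bool (?j x i < length (?w x) \<and> ?w x ! ?j x i) + (a + a) else a) (length (?w x))
      = nat \<bar>snd x\<bar>"
    by (simp only: encode_instance_layout(8) [of "fst x" "snd x", unfolded prod.collapse])
qed

lemma polyp_has_large_lens: "ppred (\<lambda>x \<rho>. has_large_lens s x)"
proof (rule polyp_cong)
  let ?n = "\<lambda>x :: instance_type. card (verts (fst x))" and ?L = "\<lambda>x. length (encode_instance x)"
  \<comment> \<open>The integer is available only as sign and absolute value: \<open>k <= 0\<close>
    becomes the first two disjuncts, and for positive \<open>k\<close> natural numbers are
    compared.\<close>
  show "ppred (\<lambda>x \<rho>. snd x < 0 \<or> nat \<bar>snd x\<bar> = 0 \<or>
      (\<exists>a<?L x. \<exists>b<?L x. \<exists>D\<le>s. a < ?n x \<and> b < ?n x \<and> reach (fst x) D a b \<and>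
         (D = 0 \<or> \<not> reach (fst x) (D - 1) a b) \<and> nat \<bar>snd x\<bar> \<le> card (lens (fst x) D a b)))"
    by (intro polyp_disj polyp_negative polyp_eq polyf_abs polyf_const polyp_ex polyp_ex_le polyp_conj
        polyp_less polyp_le polyf_var polyf_card_verts polyp_reach polyp_not polyp_const polyf_card_lens)
  fix x assume x: "x \<in> I"
  have L: "a < ?L x" if "a < ?n x" for a
    using that encode_instance_layout(1) [of "fst x" "snd x"] by simp
  show "(snd x < 0 \<or> nat \<bar>snd x\<bar> = 0 \<or>
      (\<exists>a<?L x. \<exists>b<?L x. \<exists>D\<le>s. a < ?n x \<and> b < ?n x \<and> reach (fst x) D a b \<and>
         (D = 0 \<or> \<not> reach (fst x) (D - 1) a b) \<and> nat \<bar>snd x\<bar> \<le> card (lens (fst x) D a b))) \<longleftrightarrow>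
      has_large_lens s x"
  proof (cases "snd x \<le> 0")
    case True
    then show ?thesis by (auto simp: has_large_lens_def split: prod.splits)
  next
    case False
    then have "nat \<bar>snd x\<bar> \<le> m \<longleftrightarrow> snd x \<le> int m" for m by linarith
    moreover have "(\<exists>a<?L x. \<exists>b<?L x. \<exists>D\<le>s. a < ?n x \<and> b < ?n x \<and> R a b D) \<longleftrightarrow>
        (\<exists>a<?n x. \<exists>b<?n x. \<exists>D\<le>s. R a b D)" for R
      using L by blast
    ultimately show ?thesis
      using False unfolding has_large_lens_def case_prod_beta Bex_def instances_verts_iff [OF x] by simp
  qed
qed

end

theorem theorem5:
  fixes s :: nat
  assumes "s \<ge> 1"
  shows "poly_time_solvable_on encode_instance {(G, k) \<in> instances. degeneracy G \<le> 1} (s_club_problem s) \<and>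
         poly_time_solvable_on encode_instance {(G, k) \<in> instances. degeneracy G \<le> 1} (s_clique_problem s)"
proof -
  let ?I = "{(G, k) \<in> instances. degeneracy G \<le> 1}"
  have "polyp encode_instance ?I (\<lambda>x \<rho>. has_large_lens s x)"
    by (rule polyp_has_large_lens) blast
  moreover have "s_club_problem s x \<longleftrightarrow> has_large_lens s x"
    "s_clique_problem s x \<longleftrightarrow> has_large_lens s x" if "x \<in> ?I" for x
  proof -
    from that obtain G k where x: "x = (G, k)" "simple_graph G" "degeneracy G \<le> 1"
      by (auto simp: instances_def)
    show "s_club_problem s x \<longleftrightarrow> has_large_lens s x" "s_clique_problem s x \<longleftrightarrow> has_large_lens s x"
      unfolding x(1) by (rule problems_iff_has_large_lens [OF forest_if_degeneracy_le_1 [OF x(2,3)]])+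
  qed
  ultimately show ?thesis
    by (intro conjI polyp_solvable) (auto elim!: polyp_cong simp del: split_paired_All)
qed

end
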